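(* Let $p\in[1,+\infty)$ and let $f:\mathbb B\to\mathbb H$ be a slice regular function such that $f(0)=0$, $f'(0)=1$ and $\|f\|_{A^p}\le1$, where $$\|f\|_{A^p}:=\sup_{I\in\mathbb S}\bigg(\int_{\mathbb B_I}|f_I(z)|^p\,d\sigma_I(z)\bigg)^{1/p}.$$ Then $f$ is injective on $B(0,r_p)$ and $B(0,R_p)\subset f\big(B(0,r_p)\big)$, where $$r_p=\sup_{0<r<1}\Big\{(1-r)^{-\frac2p}-\sqrt{(1-r)^{-\frac4p}-r^2}\Big\}$$ and $$R_p=\sup_{0<r<1}\Big\{r^{-2}(1-r)^{-\frac2p}\Big((1-r)^{-\frac2p}-\sqrt{(1-r)^{-\frac4p}-r^2}\Big)^2\Big\}.$$
   Context: $\mathbb H$ is the skew field of quaternions, $|\cdot|$ its Euclidean norm, $\mathbb S=\{q\in\mathbb H:q^2=-1\}$. For $I\in\mathbb S$, $\mathbb C_I=\mathbb R+\mathbb R I$, and for $\Omega\subset\mathbb H$, $\Omega_I=\Omega\cap\mathbb C_I$. $B(q_0,R)=\{q\in\mathbb H:|q-q_0|<R\}$ and $\mathbb B=B(0,1)$. $f_I$ denotes the restriction of $f$ to $\mathbb B_I$, and $d\sigma_I$ is the normalised Lebesgue measure on $\mathbb C_I$: $d\sigma_I(z)=\frac1\pi\,dx\,dy$ for $z=x+yI$. The slice regular Bergman space (of the second kind) $A^p(\mathbb B)$ consists of the slice regular $f$ on $\mathbb B$ with $\|f\|_{A^p}<\infty$. A function $f:\Omega\to\mathbb H$ on a domain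 $\Omega\subset\mathbb H$ is slice regular if for every $I\in\mathbb S$ its restriction $f_I$ to $\Omega_I$ has continuous partial derivatives and satisfies $\frac12\big(\frac{\partial}{\partial x}+I\frac{\partial}{\partial y}\big)f_I(x+yI)=0$ for all $x+yI\in\Omega_I$. On $\mathbb B$ this is equivalent to $f(q)=\sum_{n\ge0}q^na_n$ with $a_n\in\mathbb H$, the series converging absolutely and uniformly on compact subsets of $\mathbb B$. The slice derivative $f'$ is defined on each $\mathbb B_I$ by $f'(x+yI)=\frac12\big(\frac{\partial}{\partial x}-I\frac{\partial}{\partial y}\big)f_I(x+yI)$; equivalently $f'(q)=\sum_{n\ge1}q^{n-1}na_n$. *)

theory Defs
  imports "HOL-Analysis.Analysis"
begin

section \<open>The quaternions\<close>

datatype quat = Quat (qr: real) (qi: real) (qj: real) (qk: real)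

lemma quat_eq_iff: "p = q \<longleftrightarrow> qr p = qr q \<and> qi p = qi q \<and> qj p = qj q \<and> qk p = qk q"
  by (cases p; cases q) simp

instantiation quat :: real_vector
begin

definition "0 = Quat 0 0 0 0"
definition "p + q = Quat (qr p + qr q) (qi p + qi q) (qj p + qj q) (qk p + qk q)"
definition "- p = Quat (- qr p) (- qi p) (- qj p) (- qk p)"
definition "p - q = Quat (qr p - qr q) (qi p - qi q) (qj p - qj q) (qk p - qk q)" for p q :: quat
definition "r *\<^sub>R p = Quat (r * qr p) (r * qi p) (r * qj p) (r * qk p)"

instance
  by standard
    (simp_all add: quat_eq_iff zero_quat_def plus_quat_def uminus_quat_def minus_quat_def
      scaleR_quat_def algebra_simps)

end

lemma quat_sel_linear [simp]:
  "qr 0 = 0" "qi 0 = 0" "qj 0 = 0" "qk 0 = 0"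
  "qr (p + q) = qr p + qr q" "qi (p + q) = qi p + qi q"
  "qj (p + q) = qj p + qj q" "qk (p + q) = qk p + qk q"
  "qr (- p) = - qr p" "qi (- p) = - qi p" "qj (- p) = - qj p" "qk (- p) = - qk p"
  "qr (p - q) = qr p - qr q" "qi (p - q) = qi p - qi q"
  "qj (p - q) = qj p - qj q" "qk (p - q) = qk p - qk q"
  "qr (r *\<^sub>R p) = r * qr p" "qi (r *\<^sub>R p) = r * qi p"
  "qj (r *\<^sub>R p) = r * qj p" "qk (r *\<^sub>R p) = r * qk p"
  by (simp_all add: zero_quat_def plus_quat_def uminus_quat_def minus_quat_def scaleR_quat_def)

text \<open>Hamilton's product: the units \<open>i, j, k\<close> satisfy \<open>i\<^sup>2 = j\<^sup>2 = k\<^sup>2 = i j k = -1\<close>.\<close>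

instantiation quat :: real_div_algebra
begin

definition "1 = Quat 1 0 0 0"

definition "p * q = Quat
  (qr p * qr q - qi p * qi q - qj p * qj q - qk p * qk q)
  (qr p * qi q + qi p * qr q + qj p * qk q - qk p * qj q)
  (qr p * qj q - qi p * qk q + qj p * qr q + qk p * qi q)
  (qr p * qk q + qi p * qj q - qj p * qi q + qk p * qr q)"

definition inverse_quat :: "quat \<Rightarrow> quat" where
  "inverse p =
    inverse ((qr p)\<^sup>2 + (qi p)\<^sup>2 + (qj p)\<^sup>2 + (qk p)\<^sup>2) *\<^sub>R Quat (qr p) (- qi p) (- qj p) (- qk p)"

definition "p div q = p * inverse q" for p q :: quat

instance
proof
  fix p q r :: quat
  show "p * q * r = p * (q * r)" "(p + q) * r = p * r + q * r" "p * (q + r) = p * q + p * r"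
    by (simp_all add: quat_eq_iff times_quat_def algebra_simps)
  show scl: "c *\<^sub>R p * q = c *\<^sub>R (p * q)" and scr: "p * c *\<^sub>R q = c *\<^sub>R (p * q)"
    for c :: real and p q :: quat
    by (simp_all add: quat_eq_iff times_quat_def algebra_simps)
  show "1 * p = p" "p * 1 = p" "(0::quat) \<noteq> 1"
    by (simp_all add: quat_eq_iff times_quat_def one_quat_def)
  show "p div q = p * inverse q"
    by (rule divide_quat_def)
  show "inverse (0::quat) = 0"
    by (simp add: quat_eq_iff inverse_quat_def)
  assume "p \<noteq> 0"
  then have *: "(qr p)\<^sup>2 + (qi p)\<^sup>2 + (qj p)\<^sup>2 + (qk p)\<^sup>2 \<noteq> 0"
    by (auto simp: quat_eq_iff add_nonneg_eq_0_iff)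
  let ?n = "(qr p)\<^sup>2 + (qi p)\<^sup>2 + (qj p)\<^sup>2 + (qk p)\<^sup>2"
  have "Quat (qr p) (- qi p) (- qj p) (- qk p) * p = ?n *\<^sub>R 1"
    "p * Quat (qr p) (- qi p) (- qj p) (- qk p) = ?n *\<^sub>R 1"
    by (simp_all add: quat_eq_iff times_quat_def one_quat_def power2_eq_square algebra_simps)
  with * show "inverse p * p = 1" "p * inverse p = 1"
    by (simp_all add: inverse_quat_def scl scr quat_eq_iff one_quat_def)
qed

end

lemma quat_sel_mult [simp]:
  "qr 1 = 1" "qi 1 = 0" "qj 1 = 0" "qk 1 = 0"
  "qr (p * q) = qr p * qr q - qi p * qi q - qj p * qj q - qk p * qk q"
  "qi (p * q) = qr p * qi q + qi p * qr q + qj p * qk q - qk p * qj q"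
  "qj (p * q) = qr p * qj q - qi p * qk q + qj p * qr q + qk p * qi q"
  "qk (p * q) = qr p * qk q + qi p * qj q - qj p * qi q + qk p * qr q"
  by (simp_all add: one_quat_def times_quat_def)

lemma quat_sel_of_real [simp]:
  "qr (of_real x) = x" "qi (of_real x) = 0" "qj (of_real x) = 0" "qk (of_real x) = 0"
  by (simp_all add: of_real_def)

instantiation quat :: real_inner
begin

definition "inner p q = qr p * qr q + qi p * qi q + qj p * qj q + qk p * qk q"
definition "norm p = sqrt ((qr p)\<^sup>2 + (qi p)\<^sup>2 + (qj p)\<^sup>2 + (qk p)\<^sup>2)"
definition "sgn p = p /\<^sub>R norm p" for p :: quat
definition "dist p q = norm (p - q)" for p q :: quat
definition [code del]:
  "(uniformity :: (quat \<times> quat) filter) = (INF e\<in>{0 <..}. principal {(x, y). dist x y < e})"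
definition [code del]:
  "open (U :: quat set) \<longleftrightarrow> (\<forall>x\<in>U. eventually (\<lambda>(x', y). x' = x \<longrightarrow> y \<in> U) uniformity)"

instance
proof
  fix p q r :: quat and c :: real
  show "inner p q = inner q p" "inner (p + q) r = inner p r + inner q r"
    "inner (c *\<^sub>R p) q = c * inner p q"
    by (simp_all add: inner_quat_def algebra_simps)
  show "0 \<le> inner p p"
    by (simp add: inner_quat_def)
  show "inner p p = 0 \<longleftrightarrow> p = 0"
    by (auto simp: inner_quat_def quat_eq_iff add_nonneg_eq_0_iff)
  show "norm p = sqrt (inner p p)"
    by (simp add: norm_quat_def inner_quat_def power2_eq_square)
qed (rule sgn_quat_def dist_quat_def uniformity_quat_def open_quat_def)+

end

instance quat :: real_normed_div_algebra
proof
  fix p q :: quat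
  show "norm (p * q) = norm p * norm q"
    by (simp add: norm_quat_def real_sqrt_mult [symmetric] power2_eq_square algebra_simps)
qed

instantiation quat :: euclidean_space
begin

definition "Basis = {Quat 1 0 0 0, Quat 0 1 0 0, Quat 0 0 1 0, Quat 0 0 0 1}"

instance
proof
  show "(Basis :: quat set) \<noteq> {}" "finite (Basis :: quat set)"
    by (simp_all add: Basis_quat_def)
  fix u v p :: quat
  show "inner u v = (if u = v then 1 else 0)" if "u \<in> Basis" "v \<in> Basis"
    using that unfolding Basis_quat_def by (elim insertE emptyE) (simp_all add: inner_quat_def)
  show "(\<forall>u\<in>Basis. inner p u = 0) \<longleftrightarrow> p = 0"
    by (simp add: Basis_quat_def inner_quat_def quat_eq_iff [of p 0])
qed

end


section \<open>Slice regular functions\<close>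

definition imag_unit_sphere :: "quat set" (\<open>\<S>\<close>) where
  "\<S> = {q. q\<^sup>2 = -1}"

definition slice_point :: "quat \<Rightarrow> real \<Rightarrow> real \<Rightarrow> quat" where
  "slice_point I x y = of_real x + of_real y * I"

definition slice_plane :: "quat \<Rightarrow> quat set" where
  "slice_plane I = {slice_point I x y | x y. True}"

definition slice_dx :: "quat \<Rightarrow> (quat \<Rightarrow> quat) \<Rightarrow> real \<Rightarrow> real \<Rightarrow> quat" where
  "slice_dx I f x y = vector_derivative (\<lambda>t. f (slice_point I t y)) (at x)"

definition slice_dy :: "quat \<Rightarrow> (quat \<Rightarrow> quat) \<Rightarrow> real \<Rightarrow> real \<Rightarrow> quat" where
  "slice_dy I f x y = vector_derivative (\<lambda>t. f (slice_point I x t)) (at y)"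

text \<open>A function on \<open>\<Omega>\<close> is a total function whose values outside \<open>\<Omega>\<close> are
  irrelevant: \<open>\<Omega>\<close> is open, so the partial derivatives at points of \<open>\<Omega>\<close> only see values in \<open>\<Omega>\<close>.\<close>

definition slice_regular_on :: "(quat \<Rightarrow> quat) \<Rightarrow> quat set \<Rightarrow> bool" where
  "slice_regular_on f \<Omega> \<longleftrightarrow> open \<Omega> \<and> connected \<Omega> \<and>
    (\<forall>I\<in>\<S>.
      (\<forall>x y. slice_point I x y \<in> \<Omega> \<longrightarrow>
        (\<lambda>t. f (slice_point I t y)) differentiable at x \<and>
        (\<lambda>t. f (slice_point I x t)) differentiable at y) \<and>
      continuous_on {(x, y). slice_point I x y \<in> \<Omega>} (\<lambda>(x, y). slice_dx I f x y) \<and>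
      continuous_on {(x, y). slice_point I x y \<in> \<Omega>} (\<lambda>(x, y). slice_dy I f x y) \<and>
      (\<forall>x y. slice_point I x y \<in> \<Omega> \<longrightarrow>
        (1 / 2) *\<^sub>R (slice_dx I f x y + I * slice_dy I f x y) = 0))"

text \<open>A point lies on several slices (\<open>x + y I = x + (- y) (- I)\<close>, and a real point lies on all of
  them).  For slice regular \<open>f\<close> the value does not depend on the choice; see
  \<open>slice_deriv_slice_point\<close> below.\<close>

definition slice_deriv :: "(quat \<Rightarrow> quat) \<Rightarrow> quat \<Rightarrow> quat" where
  "slice_deriv f q = (THE d. \<forall>I\<in>\<S>. \<forall>x y. q = slice_point I x y \<longrightarrow>
     d = (1 / 2) *\<^sub>R (slice_dx I f x y - I * slice_dy I f x y))"

lemma imag_unit_sphere_iff: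
  "I \<in> \<S> \<longleftrightarrow> qr I = 0 \<and> (qi I)\<^sup>2 + (qj I)\<^sup>2 + (qk I)\<^sup>2 = 1"
proof
  assume I: "I \<in> \<S>"
  then have eqs: "qr I * qr I - qi I * qi I - qj I * qj I - qk I * qk I = -1"
    "qr I * qi I = 0" "qr I * qj I = 0" "qr I * qk I = 0"
    by (auto simp: imag_unit_sphere_def power2_eq_square quat_eq_iff)
  have "qr I = 0"
  proof (rule ccontr)
    assume "qr I \<noteq> 0"
    with eqs have "qr I * qr I = -1" by simp
    then show False using zero_le_square [of "qr I"] by linarith
  qed
  with eqs(1) show "qr I = 0 \<and> (qi I)\<^sup>2 + (qj I)\<^sup>2 + (qk I)\<^sup>2 = 1"
    by (simp add: power2_eq_square)
next
  assume "qr I = 0 \<and> (qi I)\<^sup>2 + (qj I)\<^sup>2 + (qk I)\<^sup>2 = 1"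
  then show "I \<in> \<S>"
    by (simp add: imag_unit_sphere_def quat_eq_iff power2_eq_square)
qed

lemma slice_point_eq_cases:
  assumes I: "I \<in> \<S>" and J: "J \<in> \<S>" and eq: "slice_point J u v = slice_point I x y"
  shows "u = x \<and> (v = y \<and> J = I \<or> v = - y \<and> J = - I \<or> v = 0 \<and> y = 0)"
proof -
  from I J have s: "qr I = 0" "(qi I)\<^sup>2 + (qj I)\<^sup>2 + (qk I)\<^sup>2 = 1"
    "qr J = 0" "(qi J)\<^sup>2 + (qj J)\<^sup>2 + (qk J)\<^sup>2 = 1"
    by (simp_all add: imag_unit_sphere_iff)
  from eq have e: "u = x" "v * qi J = y * qi I" "v * qj J = y * qj I" "v * qk J = y * qk I"
    using s by (simp_all add: slice_point_def quat_eq_iff)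
  have "v\<^sup>2 = v\<^sup>2 * ((qi J)\<^sup>2 + (qj J)\<^sup>2 + (qk J)\<^sup>2)" by (simp add: s)
  also have "\<dots> = (v * qi J)\<^sup>2 + (v * qj J)\<^sup>2 + (v * qk J)\<^sup>2"
    by (simp add: power_mult_distrib algebra_simps)
  also have "\<dots> = y\<^sup>2 * ((qi I)\<^sup>2 + (qj I)\<^sup>2 + (qk I)\<^sup>2)"
    by (simp add: e power_mult_distrib algebra_simps)
  finally have "v\<^sup>2 = y\<^sup>2" by (simp add: s)
  then have v: "v = y \<or> v = - y" by (simp add: power2_eq_iff)
  show ?thesis
  proof (cases "y = 0")
    case True
    with e v show ?thesis by auto
  next
    case False
    from v show ?thesis
    proof
      assume "v = y"
      with False e s have "J = I" by (simp add: quat_eq_iff)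
      with e \<open>v = y\<close> show ?thesis by simp
    next
      assume "v = - y"
      with False e have "y * - qi J = y * qi I" "y * - qj J = y * qj I" "y * - qk J = y * qk I"
        by simp_all
      with False s have "- J = I"
        by (simp only: mult_cancel_left quat_eq_iff) simp
      with e \<open>v = - y\<close> show ?thesis by auto
    qed
  qed
qed

lemma slice_deriv_slice_point:
  assumes f: "slice_regular_on f \<Omega>" and I: "I \<in> \<S>" and mem: "slice_point I x y \<in> \<Omega>"
  shows "slice_deriv f (slice_point I x y) =
    (1 / 2) *\<^sub>R (slice_dx I f x y - I * slice_dy I f x y)"
proof -
  have CR: "slice_dx J f u v = - (J * slice_dy J f u v)"
    if "J \<in> \<S>" "slice_point J u v \<in> \<Omega>" for J u v
    using f that by (auto simp: slice_regular_on_def eq_neg_iff_add_eq_0)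
  have neg: "slice_dx (- I) f x (- y) = slice_dx I f x y"
    by (simp add: slice_dx_def slice_point_def)
  have key: "(1 / 2) *\<^sub>R (slice_dx J f u v - J * slice_dy J f u v) = slice_dx J f u v"
    if "J \<in> \<S>" "slice_point J u v \<in> \<Omega>" for J u v
  proof -
    have "J * slice_dy J f u v = - slice_dx J f u v" using CR [OF that] by simp
    then show ?thesis by simp
  qed
  have real: "slice_dx J f x 0 = slice_dx I f x 0" for J
    by (simp add: slice_dx_def slice_point_def)
  have *: "(1 / 2) *\<^sub>R (slice_dx J f u v - J * slice_dy J f u v) = slice_dx I f x y"
    if J: "J \<in> \<S>" and eq: "slice_point I x y = slice_point J u v" for J u v
  proof -
    from eq mem have "slice_point J u v \<in> \<Omega>" by simp
    with slice_point_eq_cases [OF I J eq [symmetric]] show ?thesis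
      using key [OF J] neg real by auto
  qed
  have "slice_deriv f (slice_point I x y) = slice_dx I f x y"
    unfolding slice_deriv_def
  proof (rule the_equality)
    show "\<forall>J\<in>\<S>. \<forall>u v. slice_point I x y = slice_point J u v \<longrightarrow>
        slice_dx I f x y = (1 / 2) *\<^sub>R (slice_dx J f u v - J * slice_dy J f u v)"
      using * by metis
  next
    fix d
    assume "\<forall>J\<in>\<S>. \<forall>u v. slice_point I x y = slice_point J u v \<longrightarrow>
        d = (1 / 2) *\<^sub>R (slice_dx J f u v - J * slice_dy J f u v)"
    with I * show "d = slice_dx I f x y" by metis
  qed
  with key [OF I mem] show ?thesis by simp
qed


section \<open>The Bergman norm of the second kind\<close>

text \<open>\<open>d\<sigma>\<^sub>I = (1/\<pi>) dx dy\<close> for \<open>z = x + y I\<close>, as a Borel measure on the quaternions supported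
  on the slice plane; \<open>dx dy\<close> is taken as Lebesgue measure on the type \<^typ>\<open>complex\<close>.\<close>

definition slice_measure :: "quat \<Rightarrow> quat measure" where
  "slice_measure I =
     distr (scale_measure (ennreal (1 / pi)) lborel) borel
       (\<lambda>z::complex. slice_point I (Re z) (Im z))"

definition ennreal_powr :: "ennreal \<Rightarrow> real \<Rightarrow> ennreal" where
  "ennreal_powr a s = (if a = \<infinity> then \<infinity> else ennreal (enn2real a powr s))"

text \<open>The value is \<open>\<infinity>\<close> exactly when the slice regular \<open>f\<close> is not in \<open>A\<^sup>p\<close>.\<close>

definition bergman_norm :: "real \<Rightarrow> (quat \<Rightarrow> quat) \<Rightarrow> ennreal" where
  "bergman_norm p f =
     (SUP I\<in>\<S>. ennreal_powr
        (\<integral>\<^sup>+ z \<in> ball 0 1 \<inter> slice_plane I. ennreal (norm (f z) powr p) \<partial>slice_measure I) (1 / p))"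


section \<open>The radii\<close>

definition landau_radius :: "real \<Rightarrow> real" where
  "landau_radius p =
     (SUP r\<in>{0<..<1}. (1 - r) powr (- 2 / p) - sqrt ((1 - r) powr (- 4 / p) - r\<^sup>2))"

definition bloch_radius :: "real \<Rightarrow> real" where
  "bloch_radius p =
     (SUP r\<in>{0<..<1}. r powi (- 2) * (1 - r) powr (- 2 / p) *
        ((1 - r) powr (- 2 / p) - sqrt ((1 - r) powr (- 4 / p) - r\<^sup>2))\<^sup>2)"

end

theory Submission
  imports Defs "HOL-Complex_Analysis.Complex_Analysis"
begin

text \<open>
  Subharmonicity on slices gives \<open>|f(q)| \<le> (1 - |q|)\<close> to the power \<open>- 2 / p\<close>
  (\<open>point_evaluation\<close>), so for \<open>0 < r < 1\<close> the function \<open>f\<close> is bounded by \<open>M = (1 - r)\<close> to the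
  power \<open>- 2 / p\<close> on the ball of radius \<open>r\<close>.  After rescaling, each \<open>r\<close> reduces the claim to a theorem
  of Landau and Bloch type (\<open>landau_bloch_series\<close>): a regular function \<open>g\<close> on the unit ball with
  \<open>g(0) = 0\<close>, \<open>g'(0) = 1\<close> and \<open>|g| \<le> N\<close> is injective on the ball of radius \<open>\<rho> = N - sqrt (N\<^sup>2 - 1)\<close>, and
  the image of that ball contains the ball of radius \<open>N \<rho>\<^sup>2\<close>.  The suprema over \<open>r\<close> then give the two radii.

  The theorem for \<open>g\<close> rests on two estimates.  The first is the growth bound
  \<open>|g(q)| \<ge> N s (1 - N s) / (N - s)\<close> for \<open>s = |q|\<close> (\<open>growth\<close>), a Schwarz-Pick estimate for a complex
  component of \<open>q\<^sup>-\<^sup>1 g(q)\<close> on a slice.  The second says that \<open>g(q1) = g(q2) = w\<close> with \<open>q1 \<noteq> q2\<close>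
  forces \<open>|w| \<le> N |q1| |q2|\<close> (\<open>two_point\<close>).  Together they contradict \<open>|q1| \<le> |q2| < \<rho>\<close>, so \<open>g\<close> is injective.
  The covering statement follows from the growth bound and invariance of domain.

  In the two-point estimate \<open>q1\<close> and \<open>q2\<close> may lie on different slices.  The power series of \<open>g\<close> is
  therefore evaluated at a central complex variable \<open>z\<close>, which gives a holomorphic function with
  values in the complexified quaternions, that is, in complex two by two matrices.  For real \<open>w\<close>, to which
  a right multiplication reduces the general case, the determinant of \<open>N (g - w) (N\<^sup>2 - w g)\<^sup>-\<^sup>1\<close> is a
  scalar holomorphic function bounded by one.  It equals \<open>w\<^sup>2 / N\<^sup>2\<close> at the origin, and splitting off
  two quaternionic linear factors from \<open>g - w\<close> shows that it has four zeros, two of modulus \<open>|q1|\<close> and two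
  of modulus \<open>|q2|\<close>, counted with multiplicity; removing the Blaschke factors gives
  \<open>w\<^sup>2 / N\<^sup>2 \<le> |q1|\<^sup>2 |q2|\<^sup>2\<close>.
\<close>

section \<open>Quaternions and slices\<close>

text \<open>The embedding of the complex plane onto the slice plane of \<open>I\<close>; for \<open>I \<in> \<S>\<close> it is an isometric
  ring homomorphism.\<close>

definition slice_embed :: "quat \<Rightarrow> complex \<Rightarrow> quat" where
  "slice_embed I z = slice_point I (Re z) (Im z)"

text \<open>Quaternionic conjugation.\<close>

definition qcnj :: "quat \<Rightarrow> quat" where
  "qcnj q = Quat (qr q) (- qi q) (- qj q) (- qk q)"

lemma qcnj_sel [simp]:
  "qr (qcnj q) = qr q" "qi (qcnj q) = - qi q" "qj (qcnj q) = - qj q" "qk (qcnj q) = - qk q"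
  by (simp_all add: qcnj_def)

lemma norm_quat_squared: "(norm q)\<^sup>2 = (qr q)\<^sup>2 + (qi q)\<^sup>2 + (qj q)\<^sup>2 + (qk q)\<^sup>2"
  by (simp add: norm_quat_def)

lemma norm_qcnj [simp]: "norm (qcnj q) = norm q"
  by (simp add: norm_quat_def)

lemma mult_qcnj: "q * qcnj q = of_real ((norm q)\<^sup>2)"
  by (simp add: quat_eq_iff norm_quat_squared) (simp add: power2_eq_square)

lemma unit_square: "I \<in> \<S> \<Longrightarrow> I * I = -1"
  by (simp add: imag_unit_sphere_def power2_eq_square)

lemma norm_unit: assumes "I \<in> \<S>" shows "norm I = 1"
  using assms by (simp add: imag_unit_sphere_iff norm_quat_def)

lemma uminus_unit: "I \<in> \<S> \<Longrightarrow> - I \<in> \<S>"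
  by (simp add: imag_unit_sphere_def)

lemma unit_i: "Quat 0 1 0 0 \<in> \<S>"
  by (simp add: imag_unit_sphere_iff)

lemma inner_unit_mult_left: assumes "I \<in> \<S>" shows "inner (I * a) b = - inner a (I * b)"
  using assms by (simp add: imag_unit_sphere_iff inner_quat_def algebra_simps)

lemma inner_unit_mult_self: assumes "I \<in> \<S>" shows "inner a (I * a) = 0"
  using inner_unit_mult_left [OF assms, of a a] by (simp add: inner_commute)

lemma norm_unit_mult: "I \<in> \<S> \<Longrightarrow> norm (I * a) = norm a"
  by (simp add: norm_mult norm_unit)

text \<open>For \<open>I \<in> \<S>\<close> the vectors \<open>e\<close> and \<open>I e\<close> are orthogonal and of equal length, so this is Bessel's
  inequality.\<close>

lemma bessel_unit:
  assumes "I \<in> \<S>"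
  shows "(inner a e)\<^sup>2 + (inner a (I * e))\<^sup>2 \<le> (norm a)\<^sup>2 * (norm e)\<^sup>2"
proof -
  define s where "s = (inner a e)\<^sup>2 + (inner a (I * e))\<^sup>2"
  define v where "v = inner a e *\<^sub>R e + inner a (I * e) *\<^sub>R (I * e)"
  have "inner e e = (norm e)\<^sup>2" "inner (I * e) (I * e) = (norm e)\<^sup>2" "inner e (I * e) = 0" "inner (I * e) e = 0"
    using norm_unit_mult [OF assms, of e] inner_unit_mult_self [OF assms, of e]
    by (auto simp: power2_norm_eq_inner [symmetric] inner_commute)
  then have "(norm v)\<^sup>2 = s * (norm e)\<^sup>2"
    unfolding power2_norm_eq_inner [of v]
    by (simp add: v_def s_def inner_add_left inner_add_right) (simp add: algebra_simps power2_eq_square)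
  moreover have av: "inner a v = s"
    by (simp add: v_def s_def inner_add_right power2_eq_square)
  ultimately have "s\<^sup>2 \<le> (norm a)\<^sup>2 * (s * (norm e)\<^sup>2)"
    using Cauchy_Schwarz_ineq [of a v] by (simp add: power2_norm_eq_inner)
  then have le: "s * s \<le> s * ((norm a)\<^sup>2 * (norm e)\<^sup>2)"
    by (simp add: power2_eq_square algebra_simps)
  have "s \<ge> 0" by (simp add: s_def)
  with le show ?thesis
    unfolding s_def [symmetric] by (cases "s = 0") auto
qed

lemma slice_embed_eq: "slice_embed I z = Re z *\<^sub>R 1 + Im z *\<^sub>R I"
  by (simp add: slice_embed_def slice_point_def quat_eq_iff)

lemma slice_embed_of_real [simp]: "slice_embed I (of_real x) = of_real x"
  by (simp add: slice_embed_def slice_point_def)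

lemma slice_embed_0 [simp]: "slice_embed I 0 = 0"
  by (simp add: slice_embed_def slice_point_def)

lemma slice_embed_mult:
  assumes "I \<in> \<S>"
  shows "slice_embed I (z * w) = slice_embed I z * slice_embed I w"
  unfolding slice_embed_eq using unit_square [OF assms] by (simp add: algebra_simps)

lemma slice_embed_power:
  assumes "I \<in> \<S>"
  shows "slice_embed I z ^ n = slice_embed I (z ^ n)"
proof (induction n)
  case 0
  show ?case using slice_embed_of_real [of I 1] by simp
qed (simp add: slice_embed_mult [OF assms])

lemma norm_slice_embed [simp]:
  assumes "I \<in> \<S>"
  shows "norm (slice_embed I z) = norm z"
proof -
  have u: "qr I = 0" "(qi I)\<^sup>2 + (qj I)\<^sup>2 + (qk I)\<^sup>2 = 1"
    using assms by (simp_all add: imag_unit_sphere_iff)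
  have "(norm (slice_embed I z))\<^sup>2 = (Re z)\<^sup>2 + (Im z)\<^sup>2 * ((qi I)\<^sup>2 + (qj I)\<^sup>2 + (qk I)\<^sup>2)"
    by (simp add: norm_quat_squared slice_embed_def slice_point_def u(1))
      (simp add: power_mult_distrib algebra_simps)
  also have "\<dots> = (norm z)\<^sup>2"
    by (simp add: u(2) cmod_power2)
  finally show ?thesis by simp
qed

lemma slice_embed_exists: obtains I z where "I \<in> \<S>" "q = slice_embed I z"
proof (cases "q = of_real (qr q)")
  case True
  then show ?thesis
    using that [OF unit_i, of "of_real (qr q)"] slice_embed_of_real by simp
next
  case False
  define m where "m = sqrt ((qi q)\<^sup>2 + (qj q)\<^sup>2 + (qk q)\<^sup>2)"
  have m2: "m\<^sup>2 = (qi q)\<^sup>2 + (qj q)\<^sup>2 + (qk q)\<^sup>2"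
    by (simp add: m_def)
  have "m\<^sup>2 \<noteq> 0"
    unfolding m2 using False by (auto simp: quat_eq_iff add_nonneg_eq_0_iff)
  then have "m \<noteq> 0" by simp
  show ?thesis
  proof (rule that)
    show "Quat 0 (qi q / m) (qj q / m) (qk q / m) \<in> \<S>"
      using \<open>m\<^sup>2 \<noteq> 0\<close>
      by (simp add: imag_unit_sphere_iff power_divide m2 add_divide_distrib [symmetric])
    show "q = slice_embed (Quat 0 (qi q / m) (qj q / m) (qk q / m)) (Complex (qr q) m)"
      using \<open>m \<noteq> 0\<close> by (simp add: slice_embed_def slice_point_def quat_eq_iff)
  qed
qed

lemma slice_embed_mult_eq: "slice_embed I z * a = Re z *\<^sub>R a + Im z *\<^sub>R (I * a)"
  by (simp add: slice_embed_eq algebra_simps)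

section \<open>Power series in one quaternionic variable\<close>

text \<open>The radius of convergence of the power series with coefficients \<open>c\<close> is at least one.\<close>

definition unit_radius :: "(nat \<Rightarrow> quat) \<Rightarrow> bool" where
  "unit_radius c \<longleftrightarrow> (\<forall>r. 0 \<le> r \<longrightarrow> r < 1 \<longrightarrow> summable (\<lambda>n. norm (c n) * r ^ n))"

text \<open>The sum of the power series \<open>\<Sum> q\<^sup>n c\<^sub>n\<close>, with coefficients on the right.\<close>

definition qseries :: "(nat \<Rightarrow> quat) \<Rightarrow> quat \<Rightarrow> quat" where
  "qseries c q = (\<Sum>n. q ^ n * c n)"

lemma qseries_abs_summable:
  assumes "unit_radius c" "norm q < 1"
  shows "summable (\<lambda>n. norm (q ^ n * c n))"
  using assms by (simp add: unit_radius_def norm_mult norm_power mult.commute [of "_ ^ _"])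

lemma qseries_sums:
  assumes "unit_radius c" "norm q < 1"
  shows "(\<lambda>n. q ^ n * c n) sums qseries c q"
  using summable_norm_cancel [OF qseries_abs_summable [OF assms]]
  by (simp add: qseries_def summable_sums)

lemma qseries_0 [simp]: "qseries c 0 = c 0"
proof -
  have "(\<lambda>n. 0 ^ n * c n) sums (\<Sum>n\<in>{0}. 0 ^ n * c n)"
    by (rule sums_finite) auto
  then show ?thesis by (simp add: qseries_def sums_iff)
qed

lemma continuous_on_qseries:
  assumes "unit_radius c"
  shows "continuous_on (ball 0 1) (qseries c)"
proof -
  have "continuous_on (ball 0 r) (qseries c)" if r: "0 < r" "r < 1" for r
  proof -
    have "uniform_limit (ball 0 r) (\<lambda>N q. \<Sum>n<N. q ^ n * c n) (\<lambda>q. \<Sum>n. q ^ n * c n) sequentially"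
    proof (rule Weierstrass_m_test)
      show "norm (q ^ n * c n) \<le> norm (c n) * r ^ n" if "q \<in> ball 0 r" for q n
        using that r by (simp add: norm_mult norm_power mult.commute [of "_ ^ _"] mult_left_mono power_mono)
      show "summable (\<lambda>n. norm (c n) * r ^ n)"
        using assms r by (simp add: unit_radius_def)
    qed
    then have "continuous_on (ball 0 r) (\<lambda>q. \<Sum>n. q ^ n * c n)"
      by (rule uniform_limit_theorem [rotated]) (auto intro!: always_eventually continuous_intros)
    then show ?thesis by (simp add: qseries_def [abs_def])
  qed
  then have c: "isCont (qseries c) q" if "norm q < 1" for q
  proof -
    obtain r where "norm q < r" "r < 1" using \<open>norm q < 1\<close> dense by blast
    moreover from this have "0 < r" by (smt (verit) norm_ge_zero)
    ultimately show ?thesis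
      using \<open>\<And>r. 0 < r \<Longrightarrow> r < 1 \<Longrightarrow> continuous_on (ball 0 r) (qseries c)\<close> [of r]
      by (simp add: continuous_on_eq_continuous_at)
  qed
  then show ?thesis by (simp add: continuous_on_eq_continuous_at)
qed

lemma unit_radius_change_0:
  assumes "unit_radius d" "\<And>n. n > 0 \<Longrightarrow> norm (c n) \<le> K * norm (d n)"
  shows "unit_radius c"
  unfolding unit_radius_def
proof (intro allI impI)
  fix r :: real assume r: "0 \<le> r" "r < 1"
  then have "summable (\<lambda>n. K * (norm (d n) * r ^ n))"
    using assms(1) by (simp add: unit_radius_def)
  then show "summable (\<lambda>n. norm (c n) * r ^ n)"
  proof (rule summable_comparison_test' [where N = 1])
    show "norm (norm (c n) * r ^ n) \<le> K * (norm (d n) * r ^ n)" if "n \<ge> 1" for n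
      using mult_right_mono [OF assms(2) [of n], of "r ^ n"] r that by (simp add: mult_ac)
  qed
qed

lemma unit_radius_norm_le:
  assumes "unit_radius d" "\<And>n. norm (c n) \<le> K * norm (d n)"
  shows "unit_radius c"
  using assms by (intro unit_radius_change_0 [of d c K]) auto

lemma unit_radius_bound:
  assumes "unit_radius c" "0 \<le> r" "r < 1"
  obtains C where "C > 0" "\<And>n. norm (c n) * r ^ n \<le> C"
proof -
  have "summable (\<lambda>n. norm (c n) * r ^ n)"
    using assms by (simp add: unit_radius_def)
  then have "Bseq (\<lambda>n. norm (c n) * r ^ n)"
    by (simp add: summable_imp_Bseq)
  then obtain C where "C > 0" "\<And>n. norm (norm (c n) * r ^ n) \<le> C"
    by (auto elim: BseqE)
  then show ?thesis
    using that assms by (metis abs_of_nonneg norm_ge_zero mult_nonneg_nonneg zero_le_power real_norm_def)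
qed

lemma unit_radius_Suc:
  assumes "unit_radius c"
  shows "unit_radius (\<lambda>n. c (Suc n))"
  unfolding unit_radius_def
proof (intro allI impI)
  fix r :: real assume r: "0 \<le> r" "r < 1"
  show "summable (\<lambda>n. norm (c (Suc n)) * r ^ n)"
  proof (cases "r = 0")
    case True
    have "summable (\<lambda>n. norm (c (Suc n)) * 0 ^ n)"
      by (rule summable_finite [of "{0}"]) auto
    then show ?thesis by (simp add: True)
  next
    case False
    have "summable (\<lambda>n. norm (c (Suc n)) * r ^ Suc n)"
      using assms r by (subst summable_Suc_iff [of "\<lambda>n. norm (c n) * r ^ n"]) (simp add: unit_radius_def)
    then have "summable (\<lambda>n. (norm (c (Suc n)) * r ^ Suc n) * inverse r)"
      by (rule summable_mult2)
    then show ?thesis using False by (simp add: field_simps)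
  qed
qed

lemma qseries_Suc:
  assumes "unit_radius c" "norm q < 1"
  shows "qseries c q = c 0 + q * qseries (\<lambda>n. c (Suc n)) q"
proof -
  have "(\<lambda>n. q * (q ^ n * c (Suc n))) sums (q * qseries (\<lambda>n. c (Suc n)) q)"
    by (intro sums_mult qseries_sums unit_radius_Suc assms)
  then have "(\<lambda>n. q ^ Suc n * c (Suc n)) sums (q * qseries (\<lambda>n. c (Suc n)) q)"
    by (simp add: mult.assoc)
  then have "(\<lambda>n. q ^ n * c n) sums (q * qseries (\<lambda>n. c (Suc n)) q + q ^ 0 * c 0)"
    by (rule sums_Suc)
  with qseries_sums [OF assms] show ?thesis
    by (metis add.commute mult_1 power_0 sums_unique2)
qed

section \<open>Complex coordinates of a quaternionic power series\<close>

text \<open>The complex power series whose (real) coefficients are the components of the quaternionic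
  coefficients in the direction \<open>e\<close>.\<close>

definition qcoord :: "(nat \<Rightarrow> quat) \<Rightarrow> quat \<Rightarrow> complex \<Rightarrow> complex" where
  "qcoord c e z = (\<Sum>n. of_real (inner (c n) e) * z ^ n)"

lemma qcoord_summable:
  fixes z :: complex
  assumes "unit_radius c" "norm z < 1"
  shows "summable (\<lambda>n. of_real (inner (c n) e) * z ^ n)"
proof (rule summable_comparison_test' [where N = 0])
  show "summable (\<lambda>n. norm e * (norm (c n) * norm z ^ n))"
    using assms by (intro summable_mult) (simp add: unit_radius_def)
  show "norm (of_real (inner (c n) e) * z ^ n) \<le> norm e * (norm (c n) * norm z ^ n)" for n
    using mult_right_mono [OF Cauchy_Schwarz_ineq2 [of "c n" e], of "norm z ^ n"]
    by (simp add: norm_mult norm_power mult_ac)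
qed

lemma qcoord_sums:
  assumes "unit_radius c" "norm z < 1"
  shows "(\<lambda>n. of_real (inner (c n) e) * z ^ n) sums qcoord c e z"
  using summable_sums [OF qcoord_summable [OF assms]] by (simp add: qcoord_def)

lemma qcoord_holomorphic:
  assumes "unit_radius c"
  shows "qcoord c e holomorphic_on ball 0 1"
proof (rule power_series_holomorphic [where a = "\<lambda>n. of_real (inner (c n) e)"])
  show "(\<lambda>n. of_real (inner (c n) e) * (w - 0) ^ n) sums qcoord c e w" if "w \<in> ball 0 1" for w
    using qcoord_sums [OF assms, of w e] that by simp
qed

lemma inner_qseries:
  assumes I: "I \<in> \<S>" and c: "unit_radius c" and z: "norm z < 1"
  shows "inner (qseries c (slice_embed I z)) e = Re (qcoord c e z) - Im (qcoord c (I * e) z)"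
proof -
  have "(\<lambda>n. inner (slice_embed I z ^ n * c n) e) sums inner (qseries c (slice_embed I z)) e"
    by (rule bounded_linear.sums [OF bounded_linear_inner_left])
      (rule qseries_sums, use I c z in auto)
  moreover have "inner (slice_embed I z ^ n * c n) e =
      Re (of_real (inner (c n) e) * z ^ n) - Im (of_real (inner (c n) (I * e)) * z ^ n)" for n
    by (simp add: slice_embed_power [OF I] slice_embed_mult_eq inner_add_left
        inner_unit_mult_left [OF I])
  moreover have "(\<lambda>n. Re (of_real (inner (c n) e) * z ^ n) - Im (of_real (inner (c n) (I * e)) * z ^ n))
      sums (Re (qcoord c e z) - Im (qcoord c (I * e) z))"
    by (intro sums_diff sums_Re sums_Im qcoord_sums c z)
  ultimately show ?thesis by (simp add: sums_iff)
qed

lemma qcoord_minus: "unit_radius c \<Longrightarrow> norm z < 1 \<Longrightarrow> qcoord c (- e) z = - qcoord c e z"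
  using sums_minus [OF qcoord_sums [of c z e]] qcoord_sums [of c z "- e"]
  by (simp add: sums_iff)

section \<open>Slice components\<close>

text \<open>With left multiplication by \<open>I\<close> as the complex structure, the pairing of \<open>F\<close> with the complex line
  spanned by \<open>e\<close> in the quaternions.  For slice regular \<open>F\<close> it is a holomorphic function of one
  complex variable whose real part is \<open>\<langle>F, e\<rangle>\<close> and whose modulus is at most \<open>|F| |e|\<close>; it carries scalar
  estimates over to \<open>F\<close>.\<close>

definition slice_component :: "(quat \<Rightarrow> quat) \<Rightarrow> quat \<Rightarrow> quat \<Rightarrow> complex \<Rightarrow> complex" where
  "slice_component F I e z =
     Complex (inner (F (slice_embed I z)) e) (inner (F (slice_embed I z)) (I * e))"

lemma norm_slice_component_le:
  assumes "I \<in> \<S>"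
  shows "norm (slice_component F I e z) \<le> norm (F (slice_embed I z)) * norm e"
proof -
  have "(norm (slice_component F I e z))\<^sup>2 \<le> (norm (F (slice_embed I z)) * norm e)\<^sup>2"
    using bessel_unit [OF assms, of "F (slice_embed I z)" e]
    by (simp add: slice_component_def cmod_power2 power_mult_distrib)
  then show ?thesis by (rule power2_le_imp_le) simp
qed

lemma slice_component_qseries:
  assumes I: "I \<in> \<S>" and c: "unit_radius c" and z: "norm z < 1"
  shows "slice_component (qseries c) I e z = qcoord c e z + \<i> * qcoord c (I * e) z"
proof -
  have "I * (I * e) = - e"
    using unit_square [OF I] by (simp add: mult.assoc [symmetric])
  then show ?thesis
    using qcoord_minus [OF c z, of e]
    by (simp add: slice_component_def complex_eq_iff inner_qseries [OF I c z])
qed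

lemma slice_component_qseries_holomorphic:
  assumes I: "I \<in> \<S>" and c: "unit_radius c"
  shows "slice_component (qseries c) I e holomorphic_on ball 0 1"
proof -
  have "(\<lambda>z. qcoord c e z + \<i> * qcoord c (I * e) z) holomorphic_on ball 0 1"
    by (intro holomorphic_intros qcoord_holomorphic c)
  then show ?thesis
    by (rule holomorphic_transform) (simp add: slice_component_qseries [OF I c])
qed

section \<open>Power series of slice regular functions\<close>

text \<open>The partial derivatives along a slice are continuous, so the restriction to the slice is
  differentiable; the Cauchy-Riemann equation identifies the second partial derivative with \<open>I\<close>
  times the first.\<close>

lemma slice_regular_has_derivative:
  assumes f: "slice_regular_on f (ball 0 1)" and I: "I \<in> \<S>" and z: "norm z < 1"
  defines "D \<equiv> slice_dx I f (Re z) (Im z)"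
  shows "((\<lambda>w. f (slice_embed I w)) has_derivative (\<lambda>h. Re h *\<^sub>R D + Im h *\<^sub>R (I * D))) (at z)"
proof -
  define F where "F x y = f (slice_point I x y)" for x y
  have in_ball: "slice_point I x y \<in> ball 0 1 \<longleftrightarrow> Complex x y \<in> ball 0 1" for x y
    using norm_slice_embed [OF I, of "Complex x y"] by (simp add: slice_embed_def)
  note fI = bspec [OF conjunct2 [OF conjunct2 [OF f [unfolded slice_regular_on_def]]] I, unfolded in_ball]
  have "(\<lambda>t. F t y) differentiable at x \<and> (\<lambda>t. F x t) differentiable at y \<and>
      (1 / 2) *\<^sub>R (slice_dx I f x y + I * slice_dy I f x y) = 0"
    if "Complex x y \<in> ball 0 1" for x y
    using fI that unfolding F_def by blast
  then have diff: "(\<lambda>t. F t y) differentiable at x" "(\<lambda>t. F x t) differentiable at y"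
    and CR: "(1 / 2) *\<^sub>R (slice_dx I f x y + I * slice_dy I f x y) = 0"
    if "Complex x y \<in> ball 0 1" for x y
    using that by simp_all
  have cont: "continuous_on {(x, y). Complex x y \<in> ball 0 1} (\<lambda>(x, y). slice_dy I f x y)"
    using fI by blast
  have "open ((\<lambda>p. Complex (fst p) (snd p)) -` ball 0 1)"
    by (intro open_vimage open_ball continuous_intros)
  then have "open {(x, y). Complex x y \<in> ball 0 1}"
    by (simp add: vimage_def case_prod_unfold)
  moreover have "(Re z, Im z) \<in> {(x, y). Complex x y \<in> ball 0 1}"
    using z by simp
  ultimately obtain X Y where XY: "open X" "open Y" "(Re z, Im z) \<in> X \<times> Y"
    "X \<times> Y \<subseteq> {(x, y). Complex x y \<in> ball 0 1}"
    by (rule open_prod_elim)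
  obtain d where d: "d > 0" "ball (Im z) d \<subseteq> Y"
    using XY by (auto elim: openE)
  define Y' where "Y' = ball (Im z) d"
  have sub: "X \<times> Y' \<subseteq> {(x, y). Complex x y \<in> ball 0 1}" "open (X \<times> Y')" "(Re z, Im z) \<in> X \<times> Y'"
    using XY d by (auto simp: Y'_def intro: open_Times)
  have "((\<lambda>(x, y). F x y) has_derivative (\<lambda>(tx, ty). tx *\<^sub>R D + blinfun_scaleR_left (slice_dy I f (Re z) (Im z)) ty))
      (at (Re z, Im z) within X \<times> Y')"
  proof (rule has_derivative_partialsI)
    have "((\<lambda>x. F x (Im z)) has_vector_derivative D) (at (Re z))"
      using diff(1) [of "Re z" "Im z"] z
      by (simp add: vector_derivative_works D_def slice_dx_def F_def)
    then show "((\<lambda>x. F x (Im z)) has_derivative (\<lambda>tx. tx *\<^sub>R D)) (at (Re z) within X)"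
      by (auto simp: has_vector_derivative_def intro: has_derivative_at_withinI)
    show "((\<lambda>y. F x y) has_derivative blinfun_apply (blinfun_scaleR_left (slice_dy I f x y))) (at y within Y')"
      if "x \<in> X" "y \<in> Y'" for x y
    proof -
      have "Complex x y \<in> ball 0 1" using sub that by auto
      then have "((\<lambda>y. F x y) has_vector_derivative slice_dy I f x y) (at y)"
        using diff(2) by (simp add: vector_derivative_works slice_dy_def F_def)
      then show ?thesis
        by (auto simp: has_vector_derivative_def intro: has_derivative_at_withinI)
    qed
    have "continuous_on (X \<times> Y') (\<lambda>(x, y). slice_dy I f x y)"
      using cont sub(1) by (rule continuous_on_subset)
    then have "continuous_on (X \<times> Y') (\<lambda>p. blinfun_scaleR_left (slice_dy I f (fst p) (snd p)))"
      by (intro bounded_linear.continuous_on [OF bounded_linear_blinfun_scaleR_left])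
        (simp add: case_prod_unfold)
    then show "continuous (at (Re z, Im z) within X \<times> Y') (\<lambda>(x, y). blinfun_scaleR_left (slice_dy I f x y))"
      using sub(3) by (auto simp: case_prod_unfold continuous_on_eq_continuous_within)
  qed (use sub(3) in \<open>auto simp: Y'_def\<close>)
  then have der: "((\<lambda>(x, y). F x y) has_derivative (\<lambda>(tx, ty). tx *\<^sub>R D + ty *\<^sub>R slice_dy I f (Re z) (Im z)))
      (at (Re z, Im z))"
    using at_within_open [OF sub(3,2)] by simp
  have "((\<lambda>w. (Re w, Im w)) has_derivative (\<lambda>h. (Re h, Im h))) (at z)"
    by (auto intro!: derivative_eq_intros)
  from has_derivative_compose [OF this der] have "((\<lambda>w. F (Re w) (Im w)) has_derivative (\<lambda>h. Re h *\<^sub>R D + Im h *\<^sub>R slice_dy I f (Re z) (Im z))) (at z)"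
    by simp
  moreover have "slice_dy I f (Re z) (Im z) = I * D"
  proof -
    have "D + I * slice_dy I f (Re z) (Im z) = 0"
      using CR [of "Re z" "Im z"] z by (simp add: D_def)
    then have "D = - (I * slice_dy I f (Re z) (Im z))"
      by (simp add: eq_neg_iff_add_eq_0)
    then show ?thesis
      using unit_square [OF I] by (simp add: mult.assoc [symmetric])
  qed
  ultimately show ?thesis by (simp add: F_def slice_embed_def)
qed

lemma slice_component_holomorphic:
  assumes f: "slice_regular_on f (ball 0 1)" and I: "I \<in> \<S>"
  shows "slice_component f I e holomorphic_on ball 0 1"
proof (subst holomorphic_on_open, rule open_ball, intro ballI)
  fix z :: complex assume "z \<in> ball 0 1"
  then have z: "norm z < 1" by simp
  define D where "D = slice_dx I f (Re z) (Im z)"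
  define L where "L v = of_real (inner v e) + \<i> * of_real (inner v (I * e))" for v :: quat
  have "bounded_linear L"
    unfolding L_def
    by (intro bounded_linear_add bounded_linear_const_mult
        bounded_linear_compose [OF bounded_linear_of_real bounded_linear_inner_left])
  from bounded_linear.has_derivative [OF this slice_regular_has_derivative [OF f I z]]
  have "((\<lambda>w. L (f (slice_embed I w))) has_derivative (\<lambda>h. L (Re h *\<^sub>R D + Im h *\<^sub>R (I * D)))) (at z)"
    by (simp add: D_def)
  moreover have "L (f (slice_embed I w)) = slice_component f I e w" for w
    by (simp add: L_def slice_component_def complex_eq_iff)
  moreover have "L (Re h *\<^sub>R D + Im h *\<^sub>R (I * D)) = L D * h" for h
  proof -
    have "I * (I * e) = - e" using unit_square [OF I] by (simp add: mult.assoc [symmetric])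
    then show ?thesis
      using inner_unit_mult_left [OF I, of D e] inner_unit_mult_left [OF I, of D "I * e"]
      by (simp add: L_def complex_eq_iff inner_add_left algebra_simps)
  qed
  ultimately have "(slice_component f I e has_field_derivative L D) (at z)"
    by (simp add: has_field_derivative_def)
  then show "\<exists>d. (slice_component f I e has_field_derivative d) (at z)" ..
qed

text \<open>The coefficients come from the Taylor series of the slice components on one slice, read on the
  real axis.  Since the real axis lies in every slice, the identity theorem extends the expansion
  to all slices.\<close>

theorem slice_regular_power_series:
  assumes f: "slice_regular_on f (ball 0 1)"
  obtains c where "unit_radius c" "\<And>q. norm q < 1 \<Longrightarrow> f q = qseries c q"
proof
  define J where "J = Quat 0 1 0 0"
  have J: "J \<in> \<S>" unfolding J_def by (rule unit_i)
  define \<alpha> where "\<alpha> e n = (deriv ^^ n) (slice_component f J e) 0 / fact n" for e n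
  have \<alpha>: "(\<lambda>n. \<alpha> e n * z ^ n) sums slice_component f J e z" if "norm z < 1" for e z
    using holomorphic_power_series [OF slice_component_holomorphic [OF f J, of e], of z] that
    by (simp add: \<alpha>_def)
  define c where "c n = (\<Sum>e\<in>Basis. Re (\<alpha> e n) *\<^sub>R e)" for n
  have c_inner: "inner (c n) e = Re (\<alpha> e n)" if "e \<in> Basis" for n and e :: quat
    using that by (simp add: c_def inner_sum_left inner_Basis if_distrib cong: if_cong)
  show c: "unit_radius c"
    unfolding unit_radius_def
  proof (intro allI impI)
    fix r :: real assume r: "0 \<le> r" "r < 1"
    obtain R where R: "r < R" "R < 1" using dense r by blast
    have sm: "summable (\<lambda>n. norm (\<alpha> e n) * r ^ n)" for e
    proof -
      have "summable (\<lambda>n. \<alpha> e n * of_real R ^ n)"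
        using \<alpha> [of "of_real R" e] R r by (auto simp: sums_iff)
      then have "summable (\<lambda>n. norm (\<alpha> e n * of_real r ^ n))"
        by (rule powser_insidea) (use R r in simp)
      then show ?thesis using r by (simp add: norm_mult norm_power)
    qed
    have "summable (\<lambda>n. \<Sum>e\<in>(Basis :: quat set). norm (\<alpha> e n) * r ^ n)"
      by (intro summable_sum sm)
    then show "summable (\<lambda>n. norm (c n) * r ^ n)"
    proof (rule summable_comparison_test' [where N = 0])
      fix n
      have "norm (c n) \<le> (\<Sum>e\<in>Basis. norm (\<alpha> e n))"
        unfolding c_def
        by (intro sum_norm_le) (simp add: abs_Re_le_cmod)
      then show "norm (norm (c n) * r ^ n) \<le> (\<Sum>e\<in>Basis. norm (\<alpha> e n) * r ^ n)"
        using r by (simp add: sum_distrib_right [symmetric] mult_right_mono)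
    qed
  qed
  have real: "f (of_real x) = qseries c (of_real x)" if x: "\<bar>x\<bar> < 1" for x
  proof (rule euclidean_eqI)
    fix e :: quat assume e: "e \<in> Basis"
    have "(\<lambda>n. Re (\<alpha> e n * of_real x ^ n)) sums Re (slice_component f J e (of_real x))"
      using \<alpha> [of "of_real x" e] x by (intro sums_Re) simp
    then have "(\<lambda>n. x ^ n * Re (\<alpha> e n)) sums inner (f (of_real x)) e"
      by (simp add: slice_component_def of_real_power [symmetric] mult.commute del: of_real_power)
    moreover have "(\<lambda>n. inner (of_real x ^ n * c n) e) sums inner (qseries c (of_real x)) e"
      by (intro bounded_linear.sums [OF bounded_linear_inner_left] qseries_sums c) (use x in simp)
    then have "(\<lambda>n. x ^ n * Re (\<alpha> e n)) sums inner (qseries c (of_real x)) e"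
      by (simp add: of_real_power [symmetric] scaleR_conv_of_real [symmetric] c_inner [OF e]
          del: of_real_power)
    ultimately show "inner (f (of_real x)) e = inner (qseries c (of_real x)) e"
      by (rule sums_unique2)
  qed
  show "f q = qseries c q" if q: "norm q < 1" for q
  proof -
    obtain I z where I: "I \<in> \<S>" and qz: "q = slice_embed I z" using slice_embed_exists .
    have z: "norm z < 1" using q qz I by simp
    show ?thesis
    proof (rule euclidean_eqI)
      fix e :: quat
      have "slice_component f I e z - slice_component (qseries c) I e z = 0"
      proof (rule analytic_continuation [of "\<lambda>z. slice_component f I e z - slice_component (qseries c) I e z"
            "ball 0 1" "of_real ` {-1<..<1}" 0 z])
        show "(\<lambda>z. slice_component f I e z - slice_component (qseries c) I e z) holomorphic_on ball 0 1"
          by (intro holomorphic_intros slice_component_holomorphic f I slice_component_qseries_holomorphic c)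
        show "slice_component f I e x - slice_component (qseries c) I e x = 0"
          if "x \<in> of_real ` {-1<..<1}" for x
          using that real by (auto simp: slice_component_def)
        show "(0::complex) islimpt of_real ` {-1<..<1}"
          unfolding islimpt_approachable
        proof (intro allI impI)
          fix d :: real assume "d > 0"
          then show "\<exists>x\<in>of_real ` {-1<..<1}. x \<noteq> (0::complex) \<and> dist x 0 < d"
            by (intro bexI [of _ "of_real (min d 1 / 2)"] image_eqI [of _ _ "min d 1 / 2"])
              (auto simp: norm_divide)
        qed
      qed (use z in auto)
      then show "inner (f q) e = inner (qseries c q) e"
        by (simp add: slice_component_def complex_eq_iff qz)
    qed
  qed
qed

lemma slice_deriv_0:
  assumes f: "slice_regular_on f (ball 0 1)"
    and c: "unit_radius c" and fc: "\<And>q. norm q < 1 \<Longrightarrow> f q = qseries c q"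
  shows "slice_deriv f 0 = c 1"
proof -
  define J where "J = Quat 0 1 0 0"
  have J: "J \<in> \<S>" unfolding J_def by (rule unit_i)
  define D where "D = slice_dx J f 0 0"
  define h where "h = qseries (\<lambda>n. c (Suc n))"
  have D: "slice_deriv f 0 = D"
  proof -
    have mem: "slice_point J 0 0 \<in> ball 0 1" by (simp add: slice_point_def)
    then have "D + J * slice_dy J f 0 0 = 0"
      using f J by (auto simp: slice_regular_on_def D_def)
    then have "J * slice_dy J f 0 0 = - D" by (simp add: eq_neg_iff_add_eq_0 add.commute)
    then show ?thesis
      using slice_deriv_slice_point [OF f J mem]
      by (simp add: slice_point_def D_def [symmetric])
  qed
  have "((\<lambda>t. f (of_real t)) has_vector_derivative c 1) (at 0)"
    unfolding has_vector_derivative_def has_derivative_at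
  proof (intro conjI bounded_linear_intros)
    have contq: "isCont h 0"
      using continuous_on_qseries [OF unit_radius_Suc [OF c]]
      by (simp add: h_def continuous_on_eq_continuous_at)
    have "isCont (\<lambda>t::real. h (of_real t)) 0"
      by (rule continuous_at_compose [of 0 "of_real :: real \<Rightarrow> quat" h, unfolded o_def])
        (use contq in auto)
    then have "((\<lambda>t::real. norm (h (of_real t) - c 1)) \<longlongrightarrow> norm (h (of_real 0) - c 1)) (at 0)"
      by (intro tendsto_intros) (simp add: isCont_def)
    then have "((\<lambda>t::real. norm (h (of_real t) - c 1)) \<longlongrightarrow> 0) (at 0)"
      by (simp add: h_def)
    then show "(\<lambda>t. norm (f (of_real (0 + t)) - f (of_real 0) - t *\<^sub>R c 1) / norm t) \<midarrow>0\<rightarrow> 0"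
    proof (rule Lim_transform_eventually)
      have "eventually (\<lambda>t::real. t \<in> {-1<..<1} - {0}) (at 0)"
        by (rule eventually_at_in_open) auto
      then show "\<forall>\<^sub>F t in at 0. norm (h (of_real t) - c 1)
          = norm (f (of_real (0 + t)) - f (of_real 0) - t *\<^sub>R c 1) / norm t"
      proof eventually_elim
        case (elim t)
        then have "f (of_real t) - f 0 = t *\<^sub>R h (of_real t)"
          using qseries_Suc [OF c, of "of_real t"]
          by (simp add: fc h_def scaleR_conv_of_real abs_less_iff)
        then have "f (of_real (0 + t)) - f (of_real 0) - t *\<^sub>R c 1 = t *\<^sub>R (h (of_real t) - c 1)"
          by (simp add: scaleR_diff_right)
        then show ?case using elim by simp
      qed
    qed
  qed
  then have "vector_derivative (\<lambda>t. f (of_real t)) (at 0) = c 1"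
    by (rule vector_derivative_at)
  then show ?thesis
    unfolding D by (simp add: D_def slice_dx_def slice_point_def)
qed

section \<open>Area mean values\<close>

text \<open>Lebesgue measure on the plane is invariant under rotations, because a rotation is a product of
  three shears and shears preserve the measure by Fubini's theorem.\<close>

lemma lborel_complex_eq: "lborel = distr (lborel \<Otimes>\<^sub>M lborel) borel (\<lambda>(x, y). Complex x y)"
proof (rule lborel_eqI)
  fix l u :: complex
  assume lu: "\<And>b. b \<in> Basis \<Longrightarrow> l \<bullet> b \<le> u \<bullet> b"
  from lu [of 1] lu [of \<i>] have le: "Re l \<le> Re u" "Im l \<le> Im u"
    by (simp_all add: Basis_complex_def)
  have m: "(\<lambda>(x, y). Complex x y) \<in> borel_measurable (lborel \<Otimes>\<^sub>M lborel)"
    by (simp add: borel_prod case_prod_unfold lborel_prod)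
      (intro borel_measurable_continuous_onI continuous_intros)
  have "(\<lambda>(x, y). Complex x y) -` box l u \<inter> space (lborel \<Otimes>\<^sub>M lborel) = {Re l<..<Re u} \<times> {Im l<..<Im u}"
    by (auto simp: space_pair_measure box_def Basis_complex_def)
  then have "emeasure (distr (lborel \<Otimes>\<^sub>M lborel) borel (\<lambda>(x, y). Complex x y)) (box l u)
      = emeasure (lborel \<Otimes>\<^sub>M lborel) ({Re l<..<Re u} \<times> {Im l<..<Im u})"
    using m by (subst emeasure_distr) auto
  also have "\<dots> = ennreal (Re u - Re l) * ennreal (Im u - Im l)"
    using le by (simp add: lborel.emeasure_pair_measure_Times)
  also have "\<dots> = (\<Prod>b\<in>Basis. (u - l) \<bullet> b)"
    using le by (simp add: Basis_complex_def ennreal_mult)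
  finally show "emeasure (distr (lborel \<Otimes>\<^sub>M lborel) borel (\<lambda>(x, y). Complex x y)) (box l u)
      = (\<Prod>b\<in>Basis. (u - l) \<bullet> b)" .
qed simp

lemma measurable_Complex_pair [measurable]:
  "(\<lambda>p. Complex (fst p) (snd p)) \<in> borel_measurable (lborel \<Otimes>\<^sub>M lborel)"
  by (simp add: lborel_prod) (intro borel_measurable_continuous_onI continuous_intros)

lemma nn_integral_complex_iterated:
  fixes g :: "complex \<Rightarrow> ennreal"
  assumes [measurable]: "g \<in> borel_measurable borel"
  shows "(\<integral>\<^sup>+ z. g z \<partial>lborel) = (\<integral>\<^sup>+ y. \<integral>\<^sup>+ x. g (Complex x y) \<partial>lborel \<partial>lborel)"
    and "(\<integral>\<^sup>+ z. g z \<partial>lborel) = (\<integral>\<^sup>+ x. \<integral>\<^sup>+ y. g (Complex x y) \<partial>lborel \<partial>lborel)"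
proof -
  have gm: "(\<lambda>p. g (Complex (fst p) (snd p))) \<in> borel_measurable (lborel \<Otimes>\<^sub>M lborel)"
    by (rule measurable_compose [OF measurable_Complex_pair]) simp
  have eq: "(\<integral>\<^sup>+ z. g z \<partial>lborel) = (\<integral>\<^sup>+ p. g (Complex (fst p) (snd p)) \<partial>(lborel \<Otimes>\<^sub>M lborel))"
    using measurable_Complex_pair
    by (subst lborel_complex_eq) (simp add: nn_integral_distr case_prod_unfold)
  show "(\<integral>\<^sup>+ z. g z \<partial>lborel) = (\<integral>\<^sup>+ y. \<integral>\<^sup>+ x. g (Complex x y) \<partial>lborel \<partial>lborel)"
    unfolding eq using lborel_pair.nn_integral_snd [OF gm] by simp
  show "(\<integral>\<^sup>+ z. g z \<partial>lborel) = (\<integral>\<^sup>+ x. \<integral>\<^sup>+ y. g (Complex x y) \<partial>lborel \<partial>lborel)"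
    unfolding eq using lborel.nn_integral_fst [OF gm] by simp
qed

lemma nn_integral_translate:
  fixes g :: "real \<Rightarrow> ennreal"
  assumes [measurable]: "g \<in> borel_measurable borel"
  shows "(\<integral>\<^sup>+ x. g (t + x) \<partial>lborel) = (\<integral>\<^sup>+ x. g x \<partial>lborel)"
  using nn_integral_real_affine [of g 1 t] by simp

lemma nn_integral_shear_Re:
  fixes g :: "complex \<Rightarrow> ennreal" and a :: real
  assumes [measurable]: "g \<in> borel_measurable borel"
  shows "(\<integral>\<^sup>+ z. g (z + of_real (a * Im z)) \<partial>lborel) = (\<integral>\<^sup>+ z. g z \<partial>lborel)"
proof -
  have [measurable]: "(\<lambda>z. g (z + of_real (a * Im z))) \<in> borel_measurable borel"
    by (rule measurable_compose [OF borel_measurable_continuous_onI assms]) (intro continuous_intros)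
  have [measurable]: "(\<lambda>x. g (Complex x y)) \<in> borel_measurable borel" for y
    by (rule measurable_compose [OF borel_measurable_continuous_onI assms]) (intro continuous_intros)
  have shear: "Complex x y + of_real (a * y) = Complex (a * y + x) y" for x y
    by (simp add: complex_eq_iff)
  have "(\<integral>\<^sup>+ z. g (z + of_real (a * Im z)) \<partial>lborel)
      = (\<integral>\<^sup>+ y. \<integral>\<^sup>+ x. g (Complex (a * y + x) y) \<partial>lborel \<partial>lborel)"
    by (subst nn_integral_complex_iterated(1)) (simp_all only: shear complex.sel, simp_all)
  also have "\<dots> = (\<integral>\<^sup>+ y. \<integral>\<^sup>+ x. g (Complex x y) \<partial>lborel \<partial>lborel)"
    by (intro nn_integral_cong nn_integral_translate) simp
  also have "\<dots> = (\<integral>\<^sup>+ z. g z \<partial>lborel)"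
    by (rule nn_integral_complex_iterated(1) [symmetric]) simp
  finally show ?thesis .
qed

lemma nn_integral_shear_Im:
  fixes g :: "complex \<Rightarrow> ennreal" and a :: real
  assumes [measurable]: "g \<in> borel_measurable borel"
  shows "(\<integral>\<^sup>+ z. g (z + \<i> * of_real (a * Re z)) \<partial>lborel) = (\<integral>\<^sup>+ z. g z \<partial>lborel)"
proof -
  have [measurable]: "(\<lambda>z. g (z + \<i> * of_real (a * Re z))) \<in> borel_measurable borel"
    by (rule measurable_compose [OF borel_measurable_continuous_onI assms]) (intro continuous_intros)
  have [measurable]: "(\<lambda>y. g (Complex x y)) \<in> borel_measurable borel" for x
    by (rule measurable_compose [OF borel_measurable_continuous_onI assms]) (intro continuous_intros)
  have shear: "Complex x y + \<i> * of_real (a * x) = Complex x (a * x + y)" for x y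
    by (simp add: complex_eq_iff)
  have "(\<integral>\<^sup>+ z. g (z + \<i> * of_real (a * Re z)) \<partial>lborel)
      = (\<integral>\<^sup>+ x. \<integral>\<^sup>+ y. g (Complex x (a * x + y)) \<partial>lborel \<partial>lborel)"
    by (subst nn_integral_complex_iterated(2)) (simp_all only: shear complex.sel, simp_all)
  also have "\<dots> = (\<integral>\<^sup>+ x. \<integral>\<^sup>+ y. g (Complex x y) \<partial>lborel \<partial>lborel)"
    by (intro nn_integral_cong nn_integral_translate) simp
  also have "\<dots> = (\<integral>\<^sup>+ z. g z \<partial>lborel)"
    by (rule nn_integral_complex_iterated(2) [symmetric]) simp
  finally show ?thesis .
qed

lemma nn_integral_rotation:
  fixes g :: "complex \<Rightarrow> ennreal" and \<omega> :: complex
  assumes g: "g \<in> borel_measurable borel" and \<omega>: "norm \<omega> = 1" "Im \<omega> \<noteq> 0"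
  shows "(\<integral>\<^sup>+ z. g (\<omega> * z) \<partial>lborel) = (\<integral>\<^sup>+ z. g z \<partial>lborel)"
proof -
  \<comment> \<open>The rotation is the product of a horizontal, a vertical and the same horizontal shear;
    \<open>a\<close> is minus the tangent of half the angle.\<close>
  define a where "a = (Re \<omega> - 1) / Im \<omega>"
  define S where "S z = z + of_real (a * Im z)" for z
  define T where "T z = z + \<i> * of_real (Im \<omega> * Re z)" for z
  have c: "(Re \<omega>)\<^sup>2 + (Im \<omega>)\<^sup>2 = 1" using \<omega> by (simp add: cmod_power2 [symmetric])
  have a: "a * Im \<omega> = Re \<omega> - 1" using \<omega> by (simp add: a_def)
  have a2: "a * (Re \<omega> + 1) = - Im \<omega>"
  proof -
    have "Im \<omega> * (a * (Re \<omega> + 1)) = (a * Im \<omega>) * (Re \<omega> + 1)" by simp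
    also have "\<dots> = (Re \<omega>)\<^sup>2 - 1" by (simp add: a power2_eq_square algebra_simps)
    also have "\<dots> = Im \<omega> * (- Im \<omega>)" using c by (simp add: power2_eq_square)
    finally show ?thesis using \<omega> by (simp only: mult_cancel_left) simp
  qed
  have rot: "S (T (S z)) = \<omega> * z" for z
  proof (rule complex_eqI)
    have "Re (S (T (S z))) = (1 + a * Im \<omega>) * Re z + a * (2 + a * Im \<omega>) * Im z"
      by (simp add: S_def T_def algebra_simps)
    also have "\<dots> = Re \<omega> * Re z + (a * (Re \<omega> + 1)) * Im z" by (simp add: a add.commute)
    finally show "Re (S (T (S z))) = Re (\<omega> * z)" by (simp add: a2)
    have "Im (S (T (S z))) = Im \<omega> * Re z + (a * Im \<omega> + 1) * Im z"
      by (simp add: S_def T_def algebra_simps)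
    then show "Im (S (T (S z))) = Im (\<omega> * z)" by (simp add: a)
  qed
  have cont: "continuous_on UNIV S" "continuous_on UNIV T"
    unfolding S_def T_def by (intro continuous_intros)+
  have gS: "(\<lambda>z. g (S z)) \<in> borel_measurable borel"
    by (rule measurable_compose [OF borel_measurable_continuous_onI g]) (rule cont)
  have gST: "(\<lambda>z. g (S (T z))) \<in> borel_measurable borel"
    by (rule measurable_compose [OF borel_measurable_continuous_onI gS]) (rule cont)
  have "(\<integral>\<^sup>+ z. g (\<omega> * z) \<partial>lborel) = (\<integral>\<^sup>+ z. g (S (T (S z))) \<partial>lborel)" by (simp only: rot)
  also have "\<dots> = (\<integral>\<^sup>+ z. g (S (T z)) \<partial>lborel)"
    using nn_integral_shear_Re [OF gST, of a] by (simp only: S_def)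
  also have "\<dots> = (\<integral>\<^sup>+ z. g (S z) \<partial>lborel)"
    using nn_integral_shear_Im [OF gS, of "Im \<omega>"] by (simp only: T_def)
  also have "\<dots> = (\<integral>\<^sup>+ z. g z \<partial>lborel)"
    using nn_integral_shear_Re [OF g, of a] by (simp only: S_def)
  finally show ?thesis .
qed

lemma lborel_distr_rotation:
  fixes \<omega> :: complex
  assumes "norm \<omega> = 1" "Im \<omega> \<noteq> 0"
  shows "distr lborel borel ((*) \<omega>) = lborel"
proof (rule measure_eqI)
  fix A assume "A \<in> sets (distr lborel borel ((*) \<omega>))"
  then have A [measurable]: "A \<in> sets borel" by simp
  have "emeasure (distr lborel borel ((*) \<omega>)) A = (\<integral>\<^sup>+ z. indicator A z \<partial>distr lborel borel ((*) \<omega>))"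
    by simp
  also have "\<dots> = (\<integral>\<^sup>+ z. indicator A (\<omega> * z) \<partial>lborel)"
    by (rule nn_integral_distr) simp_all
  also have "\<dots> = (\<integral>\<^sup>+ z. indicator A z \<partial>lborel)"
    by (rule nn_integral_rotation [OF _ assms]) simp
  finally show "emeasure (distr lborel borel ((*) \<omega>)) A = emeasure lborel A" by simp
qed simp

lemma integral_disc_power:
  assumes "m > 0"
  shows "(LINT \<zeta>|lborel. indicator (cball 0 R) \<zeta> *\<^sub>R (\<zeta> :: complex) ^ m) = 0"
proof -
  define J where "J = (LINT \<zeta>|lborel. indicator (cball 0 R) \<zeta> *\<^sub>R (\<zeta> :: complex) ^ m)"
  \<comment> \<open>Rotation by this angle multiplies the integral by \<open>cis 1 \<noteq> 1\<close>, so the integral vanishes.\<close>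
  define \<omega> where "\<omega> = cis (1 / real m)"
  have \<omega>: "norm \<omega> = 1" "\<omega> ^ m = cis 1"
    using assms by (simp_all add: \<omega>_def Complex.DeMoivre)
  have "Im \<omega> > 0"
  proof -
    have "1 / real m \<le> 1" using assms by simp
    then have "1 / real m < pi" using pi_gt3 by linarith
    then show ?thesis using assms by (simp add: \<omega>_def sin_gt_zero)
  qed
  have "cis 1 \<noteq> 1"
    using sin_gt_zero [of 1] pi_gt3 by (auto simp: complex_eq_iff)
  have meas: "(\<lambda>\<zeta>. indicator (cball 0 R) \<zeta> *\<^sub>R (\<zeta> :: complex) ^ m) \<in> borel_measurable borel"
    using borel_measurable_integrable [OF borel_integrable_compact [of "cball 0 R" "\<lambda>\<zeta>::complex. \<zeta> ^ m"]]
    by (simp add: continuous_intros)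
  have "J = (LINT \<zeta>|distr lborel borel ((*) \<omega>). indicator (cball 0 R) \<zeta> *\<^sub>R \<zeta> ^ m)"
    using lborel_distr_rotation [of \<omega>] \<omega> \<open>Im \<omega> > 0\<close> by (simp add: J_def)
  also have "\<dots> = (LINT \<zeta>|lborel. indicator (cball 0 R) (\<omega> * \<zeta>) *\<^sub>R (\<omega> * \<zeta>) ^ m)"
    by (rule integral_distr [OF _ meas]) simp
  also have "\<dots> = (LINT \<zeta>|lborel. \<omega> ^ m * (indicator (cball 0 R) \<zeta> *\<^sub>R \<zeta> ^ m))"
    using \<omega> by (intro Bochner_Integration.integral_cong)
      (auto simp: power_mult_distrib indicator_def norm_mult)
  also have "\<dots> = cis 1 * J"
    by (simp only: J_def \<omega>(2) integral_mult_right_zero)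
  finally have "(1 - cis 1) * J = 0" by (simp add: algebra_simps)
  then show ?thesis using \<open>cis 1 \<noteq> 1\<close> by (simp add: J_def)
qed

text \<open>Only the constant term of the Taylor series at \<open>z\<close> contributes to the integral over the disc.\<close>

lemma area_mean_value:
  fixes u :: "complex \<Rightarrow> complex"
  assumes hol: "u holomorphic_on ball z \<rho>" and R: "0 \<le> R" "R < \<rho>"
  shows "integrable lborel (\<lambda>\<zeta>. indicator (cball 0 R) \<zeta> *\<^sub>R u (z + \<zeta>))"
    and "(LINT \<zeta>|lborel. indicator (cball 0 R) \<zeta> *\<^sub>R u (z + \<zeta>)) = of_real (pi * R\<^sup>2) * u z"
proof -
  define c where "c n = (deriv ^^ n) u z / fact n" for n
  have c: "(\<lambda>n. c n * \<zeta> ^ n) sums u (z + \<zeta>)" if "norm \<zeta> < \<rho>" for \<zeta>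
    using holomorphic_power_series [OF hol, of "z + \<zeta>"] that by (simp add: c_def dist_norm)
  have sm: "summable (\<lambda>n. norm (c n) * R ^ n)"
  proof -
    obtain S where S: "R < S" "S < \<rho>" using dense R by blast
    have "summable (\<lambda>n. c n * of_real S ^ n)"
      using c [of "of_real S"] S R by (auto simp: sums_iff)
    then have "summable (\<lambda>n. norm (c n * of_real R ^ n))"
      by (rule powser_insidea) (use S R in simp)
    then show ?thesis using R by (simp add: norm_mult norm_power)
  qed
  define g where "g n \<zeta> = c n * (indicator (cball 0 R) \<zeta> *\<^sub>R \<zeta> ^ n)" for n \<zeta>
  have meas: "emeasure lborel (cball (0::complex) R) = ennreal (pi * R\<^sup>2)"
    using R by (simp add: emeasure_cball unit_ball_vol_2 power2_eq_square)
  have int0: "integrable lborel (indicator (cball (0::complex) R) :: _ \<Rightarrow> real)"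
    using emeasure_lborel_cball_finite by (intro integrable_real_indicator) auto
  have g: "integrable lborel (g n)" for n
  proof -
    have "integrable lborel (\<lambda>\<zeta>::complex. indicator (cball 0 R) \<zeta> *\<^sub>R \<zeta> ^ n)"
      by (intro borel_integrable_compact continuous_intros compact_cball)
    then show ?thesis unfolding g_def by (rule integrable_mult_right)
  qed
  have norm_g: "norm (g n \<zeta>) \<le> norm (c n) * R ^ n * indicator (cball 0 R) \<zeta>" for n \<zeta>
    by (auto simp: g_def indicator_def norm_mult norm_power intro!: mult_left_mono power_mono)
  have AE: "AE \<zeta> in lborel. summable (\<lambda>n. norm (g n \<zeta>))"
  proof (rule AE_I2)
    fix \<zeta> :: complex
    have "summable (\<lambda>n. norm (c n) * R ^ n * indicator (cball 0 R) \<zeta>)"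
      by (rule summable_mult2 [OF sm])
    then show "summable (\<lambda>n. norm (g n \<zeta>))"
      by (rule summable_comparison_test' [where N = 0]) (simp add: norm_g)
  qed
  have sums: "summable (\<lambda>n. LINT \<zeta>|lborel. norm (g n \<zeta>))"
  proof (rule summable_comparison_test' [where N = 0])
    show "summable (\<lambda>n. norm (c n) * R ^ n * (pi * R\<^sup>2))"
      by (rule summable_mult2 [OF sm])
    fix n
    have "(LINT \<zeta>|lborel. norm (g n \<zeta>)) \<le> (LINT \<zeta>|lborel. norm (c n) * R ^ n * indicator (cball (0::complex) R) \<zeta>)"
      by (intro integral_mono integrable_norm g integrable_mult_right int0 norm_g)
    also have "\<dots> = norm (c n) * R ^ n * (pi * R\<^sup>2)"
      using meas by (simp add: measure_def)
    finally show "norm (LINT \<zeta>|lborel. norm (g n \<zeta>)) \<le> norm (c n) * R ^ n * (pi * R\<^sup>2)"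
      by (simp add: abs_of_nonneg integral_nonneg)
  qed
  have lim: "(\<Sum>n. g n \<zeta>) = indicator (cball 0 R) \<zeta> *\<^sub>R u (z + \<zeta>)" for \<zeta>
  proof (cases "\<zeta> \<in> cball 0 R")
    case True
    then have "(\<lambda>n. g n \<zeta>) sums u (z + \<zeta>)"
      using c [of \<zeta>] R by (simp add: g_def)
    with True show ?thesis by (simp add: sums_iff)
  qed (simp add: g_def)
  show "integrable lborel (\<lambda>\<zeta>. indicator (cball 0 R) \<zeta> *\<^sub>R u (z + \<zeta>))"
    using integrable_suminf [OF g AE sums] by (simp add: lim)
  have "(\<lambda>n. LINT \<zeta>|lborel. g n \<zeta>) sums (LINT \<zeta>|lborel. indicator (cball 0 R) \<zeta> *\<^sub>R u (z + \<zeta>))"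
    using sums_integral [OF g AE sums] by (simp add: lim)
  moreover have "(LINT \<zeta>|lborel. g n \<zeta>) = (if n = 0 then of_real (pi * R\<^sup>2) * u z else 0)" for n
  proof (cases "n = 0")
    case True
    have "(LINT \<zeta>|lborel. g 0 \<zeta>) = (LINT \<zeta>|lborel. indicator (cball (0::complex) R) \<zeta> *\<^sub>R c 0)"
      by (simp add: g_def)
    also have "\<dots> = (LINT \<zeta>|lborel. indicator (cball (0::complex) R) \<zeta> :: real) *\<^sub>R c 0"
      by (rule integral_scaleR_left) (rule int0)
    also have "\<dots> = c 0 * of_real (pi * R\<^sup>2)"
      using meas by (simp add: measure_def scaleR_conv_of_real)
    finally show ?thesis using True by (simp add: c_def mult.commute)
  next
    case False
    then show ?thesis
      by (simp only: g_def integral_mult_right_zero) (simp add: integral_disc_power)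
  qed
  then have "(\<lambda>n. LINT \<zeta>|lborel. g n \<zeta>) sums (of_real (pi * R\<^sup>2) * u z)"
    using sums_single [of 0 "\<lambda>_. of_real (pi * R\<^sup>2) * u z"] by simp
  ultimately show "(LINT \<zeta>|lborel. indicator (cball 0 R) \<zeta> *\<^sub>R u (z + \<zeta>)) = of_real (pi * R\<^sup>2) * u z"
    by (rule sums_unique2)
qed

section \<open>The pointwise estimate\<close>

lemma powr_tangent_line:
  fixes a t p :: real
  assumes a: "0 < a" and t: "0 \<le> t" and p: "1 \<le> p"
  shows "a powr p + p * a powr (p - 1) * (t - a) \<le> t powr p"
proof -
  have ap: "a powr p = a powr (p - 1) * a"
    using a by (simp add: powr_diff)
  show ?thesis
  proof (cases "t = 0")
    case True
    then show ?thesis using a p by (simp add: ap)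
  next
    case False
    define s where "s = t / a"
    have s: "0 < s" and ts: "t = a * s" using a t False by (simp_all add: s_def)
    \<comment> \<open>After division by \<open>a\<close> the claim is the weighted mean inequality for \<open>s powr p\<close> and \<open>1\<close>.\<close>
    have "(s powr p) powr (1 / p) * 1 powr (1 - 1 / p) \<le> 1 / p * s powr p + (1 - 1 / p) * 1"
      using p s by (intro Youngs_inequality_0) auto
    then have "s \<le> 1 / p * s powr p + (1 - 1 / p)"
      using p s by (simp add: powr_powr)
    then have "p * s \<le> p * (1 / p * s powr p + (1 - 1 / p))"
      using p by (intro mult_left_mono) auto
    also have "\<dots> = s powr p + p - 1"
      using p by (simp add: distrib_left right_diff_distrib)
    finally have "1 + p * (s - 1) \<le> s powr p"
      by (simp add: right_diff_distrib)
    then have "a powr p * (1 + p * (s - 1)) \<le> a powr p * s powr p"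
      by (rule mult_left_mono) simp
    also have "\<dots> = t powr p" using a s by (simp add: ts powr_mult)
    also have "a powr p * (1 + p * (s - 1)) = a powr p + p * a powr (p - 1) * (t - a)"
      by (simp add: ts ap algebra_simps)
    finally show ?thesis .
  qed
qed

lemma ennreal_integral_le_nn_integral:
  fixes g :: "'a \<Rightarrow> real"
  assumes "integrable M g"
  shows "ennreal (integral\<^sup>L M g) \<le> (\<integral>\<^sup>+ x. ennreal (g x) \<partial>M)"
proof -
  have "integral\<^sup>L M g \<le> enn2real (\<integral>\<^sup>+ x. ennreal (g x) \<partial>M)"
    unfolding real_lebesgue_integral_def [OF assms] by simp
  then have "ennreal (integral\<^sup>L M g) \<le> ennreal (enn2real (\<integral>\<^sup>+ x. ennreal (g x) \<partial>M))"
    by (rule ennreal_leI)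
  also have "\<dots> \<le> (\<integral>\<^sup>+ x. ennreal (g x) \<partial>M)"
    by (cases "(\<integral>\<^sup>+ x. ennreal (g x) \<partial>M) = top") (auto simp: less_top)
  finally show ?thesis .
qed

lemma slice_integral_le_1:
  assumes p: "1 \<le> p" and f: "bergman_norm p f \<le> 1" and I: "I \<in> \<S>"
  shows "(\<integral>\<^sup>+ q \<in> ball 0 1 \<inter> slice_plane I. ennreal (norm (f q) powr p) \<partial>slice_measure I) \<le> 1"
proof -
  define X where "X = (\<integral>\<^sup>+ q \<in> ball 0 1 \<inter> slice_plane I. ennreal (norm (f q) powr p) \<partial>slice_measure I)"
  have le: "ennreal_powr X (1 / p) \<le> 1"
    using f I unfolding bergman_norm_def X_def by (auto simp: SUP_le_iff)
  have fin: "X \<noteq> \<infinity>"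
    using le by (auto simp: ennreal_powr_def top_unique split: if_splits)
  have "enn2real X powr (1 / p) \<le> 1"
    using le fin by (simp add: ennreal_powr_def split: if_splits)
  then have "enn2real X \<le> 1"
    using p gr_one_powr [of "enn2real X" "1 / p"] by (meson divide_pos_pos not_le less_le_trans zero_less_one)
  then have "ennreal (enn2real X) \<le> 1"
    using ennreal_leI [of "enn2real X" 1] by simp
  then show ?thesis
    using fin by (simp add: X_def [symmetric] less_top)
qed

text \<open>The Bergman integral over a slice as an integral over the complex unit disc.\<close>

lemma slice_integral_eq:
  assumes cont: "continuous_on (ball 0 1) f" and I: "I \<in> \<S>"
  shows "(\<integral>\<^sup>+ q \<in> ball 0 1 \<inter> slice_plane I. ennreal (norm (f q) powr p) \<partial>slice_measure I)
    = ennreal (1 / pi) * (\<integral>\<^sup>+ z. ennreal (norm (f (slice_embed I z)) powr p) * indicator (ball 0 1) z \<partial>lborel)"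
proof -
  have emb: "continuous_on UNIV (slice_embed I)"
    unfolding slice_embed_eq [abs_def] by (intro continuous_intros)
  have emb_m: "slice_embed I \<in> borel_measurable borel"
    by (rule borel_measurable_continuous_onI [OF emb])
  have "(\<lambda>q. if q \<in> ball 0 1 then f q else 0) \<in> borel_measurable borel"
    by (rule borel_measurable_continuous_on_if) (use cont in auto)
  moreover have [measurable]: "ball (0::quat) 1 \<in> sets borel" by simp
  ultimately have "(\<lambda>q. ennreal (norm (if q \<in> ball 0 1 then f q else 0) powr p) * indicator (ball 0 1) q) \<in> borel_measurable borel"
    by measurable
  then have m: "(\<lambda>q. ennreal (norm (f q) powr p) * indicator (ball 0 1) q) \<in> borel_measurable borel"
    by (rule measurable_cong [THEN iffD1, rotated]) (simp add: indicator_def)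
  have "slice_plane I = {q. q - qr q *\<^sub>R 1 = inner q I *\<^sub>R I}"
  proof -
    have "inner I I = 1" using norm_unit [OF I] by (simp add: power2_norm_eq_inner [symmetric])
    moreover have "inner 1 I = 0" "qr I = 0" using I by (simp_all add: inner_quat_def imag_unit_sphere_iff)
    ultimately have "slice_point I x y \<in> {q. q - qr q *\<^sub>R 1 = inner q I *\<^sub>R I}" for x y
      by (simp add: slice_point_def of_real_def inner_add_left)
    moreover have "q = slice_point I (qr q) (inner q I)" if "q - qr q *\<^sub>R 1 = inner q I *\<^sub>R I" for q
      using that by (simp add: slice_point_def of_real_def algebra_simps)
    ultimately show ?thesis by (auto simp: slice_plane_def) blast
  qed
  moreover have "closed {q :: quat. q - inner q 1 *\<^sub>R 1 = inner q I *\<^sub>R I}"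
    by (intro closed_Collect_eq continuous_intros)
  moreover have "inner q 1 = qr q" for q by (simp add: inner_quat_def)
  ultimately have "closed (slice_plane I)" by simp
  then have pl: "slice_plane I \<in> sets borel" by simp
  have ind: "indicator (ball 0 1 \<inter> slice_plane I) q = (indicator (ball 0 1) q * indicator (slice_plane I) q :: ennreal)" for q
    by (simp add: indicator_def)
  have mm: "(\<lambda>q. ennreal (norm (f q) powr p) * indicator (ball 0 1 \<inter> slice_plane I) q) \<in> borel_measurable borel"
    unfolding ind mult.assoc [symmetric]
    by (intro borel_measurable_times_ennreal m borel_measurable_indicator pl)
  have "(\<integral>\<^sup>+ q \<in> ball 0 1 \<inter> slice_plane I. ennreal (norm (f q) powr p) \<partial>slice_measure I)
      = (\<integral>\<^sup>+ z. ennreal (norm (f (slice_embed I z)) powr p)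
          * indicator (ball 0 1 \<inter> slice_plane I) (slice_embed I z) \<partial>scale_measure (ennreal (1 / pi)) lborel)"
    unfolding slice_measure_def slice_embed_def [symmetric]
    by (subst nn_integral_distr) (use emb_m mm in auto)
  also have "\<dots> = ennreal (1 / pi) * (\<integral>\<^sup>+ z. ennreal (norm (f (slice_embed I z)) powr p)
          * indicator (ball 0 1 \<inter> slice_plane I) (slice_embed I z) \<partial>lborel)"
    by (rule nn_integral_scale_measure)
      (use measurable_compose [OF emb_m mm] in simp)
  also have "(\<lambda>z. indicator (ball 0 1 \<inter> slice_plane I) (slice_embed I z)) = (indicator (ball 0 1) :: complex \<Rightarrow> ennreal)"
    using I by (auto simp: fun_eq_iff indicator_def slice_plane_def slice_embed_def [symmetric])
      (auto simp: slice_embed_def)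
  finally show ?thesis
    using I by (simp add: fun_eq_iff)
qed

text \<open>Subharmonicity of \<open>|f|\<^sup>p\<close> on a slice, in the form of the mean value property for one slice component
  combined with convexity of the power function.\<close>

lemma point_evaluation:
  assumes p: "1 \<le> p" and f: "slice_regular_on f (ball 0 1)" and cont: "continuous_on (ball 0 1) f"
    and le1: "bergman_norm p f \<le> 1" and q: "norm q < 1"
  shows "norm (f q) \<le> (1 - norm q) powr (- 2 / p)"
proof (cases "f q = 0")
  case True
  then show ?thesis by simp
next
  case False
  define a where "a = norm (f q)"
  have a: "0 < a" using False by (simp add: a_def)
  obtain I z where I: "I \<in> \<S>" and qz: "q = slice_embed I z" using slice_embed_exists .
  have z: "norm z < 1" and nz: "norm z = norm q" using q qz I by simp_all
  \<comment> \<open>The slice component in the direction of \<open>f q\<close> has real part \<open>|f q|\<close> at the point itself.\<close>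
  define e where "e = f q /\<^sub>R a"
  have e: "norm e = 1" using a by (simp add: e_def a_def)
  define u where "u = slice_component f I e"
  have hol: "u holomorphic_on ball z (1 - norm z)"
  proof (rule holomorphic_on_subset)
    show "u holomorphic_on ball 0 1" unfolding u_def by (rule slice_component_holomorphic [OF f I])
    show "ball z (1 - norm z) \<subseteq> ball 0 1" by (simp add: ball_subset_ball_iff)
  qed
  have uz: "Re (u z) = a"
    using a by (simp add: u_def slice_component_def e_def qz [symmetric] power2_norm_eq_inner [symmetric])
      (simp add: a_def [symmetric] power2_eq_square)
  have Re_u: "Re (u w) \<le> norm (f (slice_embed I w))" for w
    using norm_slice_component_le [OF I, of f e w] complex_Re_le_cmod [of "u w"] e by (simp add: u_def)
  have main: "a powr p * R\<^sup>2 \<le> 1" if R: "0 \<le> R" "R < 1 - norm z" for R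
  proof -
    define g where "g w = indicator (cball 0 R) w * (a powr p + p * a powr (p - 1) * (Re (u (z + w)) - a))" for w
    define G where "G w = ennreal (norm (f (slice_embed I w)) powr p) * indicator (ball 0 1) w" for w
    note mv = area_mean_value [OF hol R]
    have intI: "integrable lborel (indicator (cball (0::complex) R) :: _ \<Rightarrow> real)"
      using emeasure_lborel_cball_finite by (intro integrable_real_indicator) auto
    have area: "(LINT w|lborel. indicator (cball (0::complex) R) w) = pi * R\<^sup>2"
      using R by (simp add: measure_def emeasure_cball unit_ball_vol_2 power2_eq_square)
    have intRe: "integrable lborel (\<lambda>w. indicator (cball 0 R) w * Re (u (z + w)))"
      and Re: "(LINT w|lborel. indicator (cball 0 R) w * Re (u (z + w))) = pi * R\<^sup>2 * a"
      using integrable_Re [OF mv(1)] integral_Re [OF mv(1)] mv(2) uz by simp_all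
    have g_eq: "g w = (a powr p - p * a powr (p - 1) * a) * indicator (cball 0 R) w
        + p * a powr (p - 1) * (indicator (cball 0 R) w * Re (u (z + w)))" for w
      by (simp add: g_def algebra_simps)
    have g: "integrable lborel g"
      unfolding g_eq [abs_def] by (intro Bochner_Integration.integrable_add integrable_mult_right intI intRe)
    have int_g: "integral\<^sup>L lborel g = a powr p * (pi * R\<^sup>2)"
    proof -
      have "integral\<^sup>L lborel g = (a powr p - p * a powr (p - 1) * a) * (pi * R\<^sup>2)
          + p * a powr (p - 1) * (pi * R\<^sup>2 * a)"
        unfolding g_eq [abs_def]
        by (subst Bochner_Integration.integral_add)
          (simp_all only: integral_mult_right_zero integrable_mult_right intI intRe Re area)
      then show ?thesis by (simp add: algebra_simps)
    qed
    have "ennreal (a powr p * (pi * R\<^sup>2)) \<le> (\<integral>\<^sup>+ w. ennreal (g w) \<partial>lborel)"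
      using ennreal_integral_le_nn_integral [OF g] by (simp add: int_g)
    also have "\<dots> \<le> (\<integral>\<^sup>+ w. G (z + w) \<partial>lborel)"
    proof (rule nn_integral_mono)
      fix w :: complex
      show "ennreal (g w) \<le> G (z + w)"
      proof (cases "w \<in> cball 0 R")
        case True
        define t where "t = norm (f (slice_embed I (z + w)))"
        have "norm (z + w) < 1" using norm_triangle_ineq [of z w] True R by simp
        then have G: "G (z + w) = ennreal (t powr p)" by (simp add: G_def t_def)
        have "g w = a powr p + p * a powr (p - 1) * (Re (u (z + w)) - a)" using True by (simp add: g_def)
        also have "\<dots> \<le> a powr p + p * a powr (p - 1) * (t - a)"
          using Re_u [of "z + w"] p by (intro add_left_mono mult_left_mono) (auto simp: t_def)
        also have "\<dots> \<le> t powr p"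
          using powr_tangent_line [OF a _ p, of t] by (simp add: t_def)
        finally show ?thesis unfolding G by (rule ennreal_leI)
      qed (simp add: g_def)
    qed
    also have "\<dots> = (\<integral>\<^sup>+ w. G w \<partial>lborel)"
    proof -
      have "(\<lambda>w. if w \<in> ball 0 1 then f (slice_embed I w) else 0) \<in> borel_measurable borel"
      proof (rule borel_measurable_continuous_on_if)
        show "continuous_on (ball 0 1) (\<lambda>w. f (slice_embed I w))"
        proof (rule continuous_on_compose2 [OF cont])
          show "continuous_on (ball 0 1) (slice_embed I)"
            unfolding slice_embed_eq [abs_def] by (intro continuous_intros)
        qed (use I in auto)
      qed auto
      moreover have [measurable]: "ball (0::complex) 1 \<in> sets borel" by simp
      ultimately have "(\<lambda>w. ennreal (norm (if w \<in> ball 0 1 then f (slice_embed I w) else 0) powr p) * indicator (ball 0 1) w)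
          \<in> borel_measurable borel"
        by measurable
      then have G: "G \<in> borel_measurable borel"
        by (rule measurable_cong [THEN iffD1, rotated]) (simp add: indicator_def G_def)
      have "(\<integral>\<^sup>+ w. G w \<partial>lborel) = (\<integral>\<^sup>+ w. G w \<partial>distr lborel borel ((+) z))"
        by (simp add: lborel_distr_plus)
      also have "\<dots> = (\<integral>\<^sup>+ w. G (z + w) \<partial>lborel)"
        using G by (intro nn_integral_distr) simp_all
      finally show ?thesis by simp
    qed
    finally have "ennreal (1 / pi) * ennreal (a powr p * (pi * R\<^sup>2)) \<le> ennreal (1 / pi) * (\<integral>\<^sup>+ w. G w \<partial>lborel)"
      by (rule mult_left_mono) simp
    also have "\<dots> \<le> 1"
      using slice_integral_le_1 [OF p le1 I] unfolding slice_integral_eq [OF cont I] G_def .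
    also have "ennreal (1 / pi) * ennreal (a powr p * (pi * R\<^sup>2)) = ennreal (a powr p * R\<^sup>2)"
      by (simp add: ennreal_mult [symmetric])
    finally show ?thesis by simp
  qed
  have "((\<lambda>R. a powr p * R\<^sup>2) \<longlongrightarrow> a powr p * (1 - norm z)\<^sup>2) (at_left (1 - norm z))"
    by (intro tendsto_intros)
  moreover have "eventually (\<lambda>R. a powr p * R\<^sup>2 \<le> 1) (at_left (1 - norm z))"
    using eventually_at_left_real [of 0 "1 - norm z"] z
    by (auto elim!: eventually_mono intro!: main)
  ultimately have "a powr p * (1 - norm z)\<^sup>2 \<le> 1"
    by (rule tendsto_upperbound) simp
  then have "a powr p \<le> 1 / (1 - norm q)\<^sup>2"
    using q nz by (simp add: pos_le_divide_eq)
  also have "\<dots> = (1 - norm q) powr (- 2)"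
    using q by (simp add: powr_minus_divide)
  finally have "(a powr p) powr (1 / p) \<le> ((1 - norm q) powr (- 2)) powr (1 / p)"
    using p by (intro powr_mono2) auto
  then show ?thesis
    using a p by (simp add: powr_powr a_def)
qed

section \<open>Blaschke factors\<close>

lemma blaschke_identity:
  fixes a w :: complex
  shows "(norm (1 - cnj a * w))\<^sup>2 = (norm (w - a))\<^sup>2 + (1 - (norm a)\<^sup>2) * (1 - (norm w)\<^sup>2)"
  by (simp add: cmod_power2) (simp add: power2_eq_square algebra_simps)

text \<open>A bound for \<open>(z - a) \<psi>(z)\<close> on the disc passes to \<open>(1 - cnj a z) \<psi>(z)\<close>, because the two linear factors
  have the same modulus on the unit circle.  For \<open>a = 0\<close> this is the Schwarz lemma.\<close>

lemma blaschke_factor_removal: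
  fixes \<psi> :: "complex \<Rightarrow> complex" and a :: complex
  assumes hol: "\<psi> holomorphic_on ball 0 1" and a: "norm a < 1"
    and bound: "\<And>z. norm z < 1 \<Longrightarrow> norm ((z - a) * \<psi> z) \<le> B"
    and z: "norm z < 1"
  shows "norm ((1 - cnj a * z) * \<psi> z) \<le> B"
proof -
  have "B \<ge> 0" using bound [OF z] norm_ge_zero order_trans by blast
  define g where "g w = (1 - cnj a * w) * \<psi> w" for w
  have holg: "g holomorphic_on ball 0 1"
    unfolding g_def by (intro holomorphic_intros hol)
  have key: "(norm (g z))\<^sup>2 \<le> B\<^sup>2 * (1 + (1 - r\<^sup>2) / (r - norm a)\<^sup>2)"
    if r: "max (norm a) (norm z) < r" "r < 1" for r
  proof -
    have "0 < r" using r by (smt (verit) norm_ge_zero max.cobounded1)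
    have sub: "cball 0 r \<subseteq> ball (0::complex) 1" using r by auto
    have "g holomorphic_on ball 0 r" "continuous_on (closure (ball 0 r)) g"
      using holomorphic_on_subset [OF holg order_trans [OF ball_subset_cball sub]] \<open>0 < r\<close>
        continuous_on_subset [OF holomorphic_on_imp_continuous_on [OF holg] sub]
      by auto
    then obtain w where w: "w \<in> frontier (ball 0 r)"
      and le: "\<And>x. x \<in> closure (ball 0 r) \<Longrightarrow> norm (g x) \<le> norm (g w)"
      using \<open>0 < r\<close> by (elim Schwarz1) auto
    have nw: "norm w = r" using w \<open>0 < r\<close> by auto
    have d: "r - norm a \<le> norm (w - a)" using norm_triangle_ineq2 [of w a] nw by simp
    have pos: "0 < r - norm a" using r by simp
    have "(norm (g z))\<^sup>2 \<le> (norm (g w))\<^sup>2"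
      using le [of z] r \<open>0 < r\<close> by (simp add: power_mono)
    also have "\<dots> = (norm (1 - cnj a * w))\<^sup>2 * (norm (\<psi> w))\<^sup>2"
      by (simp add: g_def norm_mult power_mult_distrib)
    also have "\<dots> \<le> ((norm (w - a))\<^sup>2 * (1 + (1 - r\<^sup>2) / (r - norm a)\<^sup>2)) * (norm (\<psi> w))\<^sup>2"
    proof (rule mult_right_mono)
      have r2: "0 \<le> 1 - r\<^sup>2" using r \<open>0 < r\<close> by (simp add: power_le_one)
      have "1 - (norm a)\<^sup>2 \<le> (norm (w - a))\<^sup>2 / (r - norm a)\<^sup>2"
      proof -
        have "1 \<le> (norm (w - a))\<^sup>2 / (r - norm a)\<^sup>2"
          using d pos by (simp add: power_mono)
        then show ?thesis by (smt (verit) zero_le_power2)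
      qed
      then have "(1 - (norm a)\<^sup>2) * (1 - r\<^sup>2) \<le> (norm (w - a))\<^sup>2 / (r - norm a)\<^sup>2 * (1 - r\<^sup>2)"
        using r2 by (rule mult_right_mono)
      then show "(norm (1 - cnj a * w))\<^sup>2 \<le> (norm (w - a))\<^sup>2 * (1 + (1 - r\<^sup>2) / (r - norm a)\<^sup>2)"
        unfolding blaschke_identity nw by (simp add: algebra_simps)
    qed simp
    also have "\<dots> = (norm ((w - a) * \<psi> w))\<^sup>2 * (1 + (1 - r\<^sup>2) / (r - norm a)\<^sup>2)"
      by (simp add: norm_mult power_mult_distrib)
    also have "\<dots> \<le> B\<^sup>2 * (1 + (1 - r\<^sup>2) / (r - norm a)\<^sup>2)"
    proof (intro mult_right_mono power_mono)
      show "norm ((w - a) * \<psi> w) \<le> B" using bound nw r by simp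
      have "r\<^sup>2 \<le> 1" using r \<open>0 < r\<close> by (simp add: power_le_one)
      then show "0 \<le> 1 + (1 - r\<^sup>2) / (r - norm a)\<^sup>2" by simp
    qed simp
    finally show ?thesis .
  qed
  have "((\<lambda>r. B\<^sup>2 * (1 + (1 - r\<^sup>2) / (r - norm a)\<^sup>2)) \<longlongrightarrow> B\<^sup>2 * (1 + (1 - 1\<^sup>2) / (1 - norm a)\<^sup>2)) (at_left 1)"
    using a by (intro tendsto_intros) auto
  moreover have "eventually (\<lambda>r. (norm (g z))\<^sup>2 \<le> B\<^sup>2 * (1 + (1 - r\<^sup>2) / (r - norm a)\<^sup>2)) (at_left 1)"
    using eventually_at_left_real [of "max (norm a) (norm z)" 1] a z
    by (auto elim!: eventually_mono intro!: key)
  ultimately have "(norm (g z))\<^sup>2 \<le> B\<^sup>2 * (1 + (1 - 1\<^sup>2) / (1 - norm a)\<^sup>2)"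
    by (rule tendsto_lowerbound) simp
  then have "(norm (g z))\<^sup>2 \<le> B\<^sup>2" by simp
  then show ?thesis
    using \<open>B \<ge> 0\<close> unfolding g_def by (rule power2_le_imp_le)
qed

section \<open>The complexified norm form\<close>

text \<open>The quadratic form \<open>\<Sum> x\<^sub>e\<^sup>2\<close> of the complexified quaternion \<open>A + \<i> B\<close>, where \<open>\<i>\<close> is central; it is the
  determinant of \<open>A + \<i> B\<close> as a complex two by two matrix.\<close>

definition pair_form :: "quat \<Rightarrow> quat \<Rightarrow> complex" where
  "pair_form A B = Complex ((norm A)\<^sup>2 - (norm B)\<^sup>2) (2 * inner A B)"

lemma norm_squared_slice_pair:
  assumes "I \<in> \<S>"
  shows "(norm (A + I * B))\<^sup>2 * (norm (A - I * B))\<^sup>2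
    = ((norm A)\<^sup>2 + (norm B)\<^sup>2)\<^sup>2 - 4 * (inner A (I * B))\<^sup>2"
proof -
  have "(norm (A + I * B))\<^sup>2 = (norm A)\<^sup>2 + (norm (I * B))\<^sup>2 + 2 * inner A (I * B)"
    "(norm (A - I * B))\<^sup>2 = (norm A)\<^sup>2 + (norm (I * B))\<^sup>2 - 2 * inner A (I * B)"
    unfolding power2_norm_eq_inner
    by (simp_all add: inner_add_left inner_add_right inner_diff_left inner_diff_right
        inner_commute [of "I * B" A])
  then show ?thesis
    by (simp only: norm_unit_mult [OF assms]) (simp add: power2_eq_square algebra_simps)
qed

lemma norm_squared_pair_form:
  "(norm (pair_form A B))\<^sup>2
    = ((norm A)\<^sup>2 + (norm B)\<^sup>2)\<^sup>2 - 4 * ((norm A)\<^sup>2 * (norm B)\<^sup>2 - (inner A B)\<^sup>2)"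
  by (simp add: pair_form_def cmod_power2) (simp add: power2_eq_square algebra_simps)

text \<open>The numbers \<open>|A + I B|\<close> and \<open>|A - I B|\<close> play the role of singular values of \<open>A + \<i> B\<close>: their product
  is at least the modulus of the determinant for every \<open>I\<close>, with equality for one choice of \<open>I\<close>.\<close>

lemma pair_form_le:
  assumes "I \<in> \<S>"
  shows "norm (pair_form A B) \<le> norm (A + I * B) * norm (A - I * B)"
proof (rule power2_le_imp_le)
  show "(norm (pair_form A B))\<^sup>2 \<le> (norm (A + I * B) * norm (A - I * B))\<^sup>2"
    using bessel_unit [OF assms, of A B]
    by (simp add: power_mult_distrib norm_squared_slice_pair [OF assms] norm_squared_pair_form)
qed simp

lemma pair_form_attained:
  obtains I where "I \<in> \<S>" "norm (pair_form A B) = norm (A + I * B) * norm (A - I * B)"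
proof -
  \<comment> \<open>The optimal \<open>I\<close> is the direction of the imaginary part of \<open>A * qcnj B\<close>.\<close>
  define V where "V = A * qcnj B"
  define m where "m = sqrt ((qi V)\<^sup>2 + (qj V)\<^sup>2 + (qk V)\<^sup>2)"
  have m2: "m\<^sup>2 = (qi V)\<^sup>2 + (qj V)\<^sup>2 + (qk V)\<^sup>2"
    by (simp add: m_def)
  have lagrange: "m\<^sup>2 = (norm A)\<^sup>2 * (norm B)\<^sup>2 - (inner A B)\<^sup>2"
    unfolding m2 V_def norm_quat_squared inner_quat_def
    by (simp add: power2_eq_square algebra_simps)
  have inn: "inner A (I * B) = qi I * qi V + qj I * qj V + qk I * qk V" if "I \<in> \<S>" for I
    using that by (simp add: imag_unit_sphere_iff V_def inner_quat_def algebra_simps)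
  have "\<exists>I\<in>\<S>. (inner A (I * B))\<^sup>2 = m\<^sup>2"
  proof (cases "m = 0")
    case True
    then have "qi V = 0" "qj V = 0" "qk V = 0"
      using m2 by (auto simp: add_nonneg_eq_0_iff)
    with True inn [OF unit_i] unit_i show ?thesis by auto
  next
    case False
    define I where "I = Quat 0 (qi V / m) (qj V / m) (qk V / m)"
    have I: "I \<in> \<S>"
      using False
      by (simp add: I_def imag_unit_sphere_iff power_divide m2 [symmetric] add_divide_distrib [symmetric])
    have "inner A (I * B) = ((qi V)\<^sup>2 + (qj V)\<^sup>2 + (qk V)\<^sup>2) / m"
      using inn [OF I] by (simp add: I_def power2_eq_square add_divide_distrib)
    also have "\<dots> = m"
      unfolding m2 [symmetric] using False by (simp add: power2_eq_square)
    finally show ?thesis using I by auto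
  qed
  then obtain I where I: "I \<in> \<S>" and t: "(inner A (I * B))\<^sup>2 = m\<^sup>2" by blast
  have "(norm (pair_form A B))\<^sup>2 = (norm (A + I * B) * norm (A - I * B))\<^sup>2"
    by (simp add: power_mult_distrib norm_squared_slice_pair [OF I] norm_squared_pair_form t lagrange)
  then have "norm (pair_form A B) = norm (A + I * B) * norm (A - I * B)"
    by (rule power2_eq_imp_eq) auto
  with I that show ?thesis by blast
qed

text \<open>For complex or quaternionic \<open>f\<close> and \<open>e = 1\<close> this says that \<open>f \<mapsto> N (f - w) / (N\<^sup>2 - w f)\<close> maps the
  ball of radius \<open>N\<close> into the closed unit ball.\<close>

lemma norm_moebius_le:
  fixes f e :: "'a :: real_inner" and N w :: real
  assumes e: "norm e = 1" and f: "norm f \<le> N" and w: "\<bar>w\<bar> \<le> N"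
  shows "N * norm (f - w *\<^sub>R e) \<le> norm (N\<^sup>2 *\<^sub>R e - w *\<^sub>R f)"
proof (rule power2_le_imp_le)
  have N: "0 \<le> N" using f norm_ge_zero order_trans by blast
  have ee: "inner e e = 1" using e by (simp add: power2_norm_eq_inner [symmetric])
  have a: "(norm (f - w *\<^sub>R e))\<^sup>2 = (norm f)\<^sup>2 - 2 * w * inner f e + w\<^sup>2"
    unfolding power2_norm_eq_inner
    by (simp add: inner_diff_left inner_diff_right ee inner_commute [of e f])
      (simp add: power2_eq_square algebra_simps)
  have b: "(norm (N\<^sup>2 *\<^sub>R e - w *\<^sub>R f))\<^sup>2 = N ^ 4 - 2 * N\<^sup>2 * w * inner f e + w\<^sup>2 * (norm f)\<^sup>2"
    unfolding power2_norm_eq_inner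
    by (simp add: inner_diff_left inner_diff_right ee inner_commute [of e f])
      (simp add: power2_eq_square power4_eq_xxxx algebra_simps)
  have "0 \<le> (N\<^sup>2 - w\<^sup>2) * (N\<^sup>2 - (norm f)\<^sup>2)"
    using f w N by (intro mult_nonneg_nonneg) (simp_all add: abs_le_square_iff [symmetric] power_mono)
  then show "(N * norm (f - w *\<^sub>R e))\<^sup>2 \<le> (norm (N\<^sup>2 *\<^sub>R e - w *\<^sub>R f))\<^sup>2"
    unfolding power_mult_distrib a b by (simp add: power2_eq_square power4_eq_xxxx algebra_simps)
qed simp

text \<open>The preceding estimate for determinants: if \<open>A + I B\<close> stays in the ball of radius \<open>N\<close> for every \<open>I\<close>,
  the determinant of the Moebius transform of \<open>A + \<i> B\<close> has modulus at most one.\<close>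

lemma pair_form_moebius:
  assumes bound: "\<And>I. I \<in> \<S> \<Longrightarrow> norm (A + I * B) \<le> N" and w: "0 \<le> w" "w < N"
  shows "N\<^sup>2 * norm (pair_form (A - of_real w) B)
      \<le> norm (pair_form (of_real (N\<^sup>2) - w *\<^sub>R A) (- (w *\<^sub>R B)))"
    and "pair_form (of_real (N\<^sup>2) - w *\<^sub>R A) (- (w *\<^sub>R B)) \<noteq> 0"
proof -
  obtain I where I: "I \<in> \<S>" and eq: "norm (pair_form (of_real (N\<^sup>2) - w *\<^sub>R A) (- (w *\<^sub>R B)))
      = norm (of_real (N\<^sup>2) - w *\<^sub>R (A + I * B)) * norm (of_real (N\<^sup>2) - w *\<^sub>R (A - I * B))"
    by (rule pair_form_attained [of "of_real (N\<^sup>2) - w *\<^sub>R A" "- (w *\<^sub>R B)"])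
      (simp add: algebra_simps)
  have plus: "norm (A + I * B) \<le> N" and minus: "norm (A - I * B) \<le> N"
    using bound [OF I] bound [OF uminus_unit [OF I]] by simp_all
  have "N\<^sup>2 * norm (pair_form (A - of_real w) B)
      \<le> N\<^sup>2 * (norm (A - of_real w + I * B) * norm (A - of_real w - I * B))"
    by (intro mult_left_mono pair_form_le I) simp
  also have "\<dots> = (N * norm (A + I * B - of_real w)) * (N * norm (A - I * B - of_real w))"
    by (simp add: power2_eq_square algebra_simps)
  also have "\<dots> \<le> norm (of_real (N\<^sup>2) - w *\<^sub>R (A + I * B)) * norm (of_real (N\<^sup>2) - w *\<^sub>R (A - I * B))"
    using w norm_moebius_le [OF norm_one plus, of w] norm_moebius_le [OF norm_one minus, of w]
    by (intro mult_mono) (auto simp: of_real_def)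
  finally show "N\<^sup>2 * norm (pair_form (A - of_real w) B)
      \<le> norm (pair_form (of_real (N\<^sup>2) - w *\<^sub>R A) (- (w *\<^sub>R B)))"
    by (simp only: eq)
  have pos: "norm (of_real (N\<^sup>2) - w *\<^sub>R f) > 0" if "norm f \<le> N" for f :: quat
  proof -
    have "norm (w *\<^sub>R f) \<le> w * N" using that w by (simp add: mult_left_mono)
    also have "\<dots> < N\<^sup>2" using w by (simp add: power2_eq_square)
    also have "N\<^sup>2 = norm (of_real (N\<^sup>2) :: quat)" by (simp only: norm_of_real) simp
    finally show ?thesis by auto
  qed
  have "norm (pair_form (of_real (N\<^sup>2) - w *\<^sub>R A) (- (w *\<^sub>R B))) > 0"
    unfolding eq by (intro mult_pos_pos pos plus minus)
  then show "pair_form (of_real (N\<^sup>2) - w *\<^sub>R A) (- (w *\<^sub>R B)) \<noteq> 0"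
    by auto
qed

section \<open>Division of power series by a linear factor\<close>

text \<open>In the ring of power series with central variable \<open>z\<close> and quaternionic coefficients, the
  recurrence \<open>c\<^sub>0 = - q d\<^sub>0\<close>, \<open>c\<^sub>n\<^sub>+\<^sub>1 = d\<^sub>n - q d\<^sub>n\<^sub>+\<^sub>1\<close> says that \<open>c = (z - q) d\<close>.\<close>

lemma unit_radius_shift: "unit_radius c \<Longrightarrow> unit_radius (\<lambda>m. c (k + m))"
proof (induction k)
  case (Suc k)
  then show ?case using unit_radius_Suc [of "\<lambda>m. c (k + m)"] by simp
qed simp

lemma qseries_divide_linear:
  assumes c: "unit_radius c" and q: "norm q < 1" and root: "qseries c q = 0"
  obtains d where "unit_radius d" "c 0 = - (q * d 0)" "\<And>n. c (Suc n) = d n - q * d (Suc n)"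
proof
  define d where "d n = qseries (\<lambda>m. c (Suc n + m)) q" for n
  show "c (Suc n) = d n - q * d (Suc n)" for n
    using qseries_Suc [OF unit_radius_shift [OF c, of "Suc n"] q] by (simp add: d_def)
  show "c 0 = - (q * d 0)"
    using qseries_Suc [OF c q] root by (simp add: d_def eq_neg_iff_add_eq_0)
  show "unit_radius d"
    unfolding unit_radius_def
  proof (intro allI impI)
    fix r :: real assume r: "0 \<le> r" "r < 1"
    obtain R where R: "max r (norm q) < R" "R < 1"
      using dense [of "max r (norm q)" 1] r q by auto
    then have R0: "0 < R" using r by linarith
    obtain C where C: "C > 0" "\<And>n. norm (c n) * R ^ n \<le> C"
      using unit_radius_bound [OF c, of R] R R0 by auto
    define K where "K = C / R / (1 - norm q / R)"
    have le: "norm (d n) \<le> K * (1 / R) ^ n" for n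
    proof -
      have bound: "norm (q ^ m * c (Suc n + m)) \<le> C / R ^ Suc n * (norm q / R) ^ m" for m
      proof -
        have "norm (c (Suc n + m)) \<le> C / R ^ (Suc n + m)"
          using C(2) [of "Suc n + m"] R0 by (simp add: pos_le_divide_eq)
        then have "norm q ^ m * norm (c (Suc n + m)) \<le> norm q ^ m * (C / R ^ (Suc n + m))"
          by (intro mult_left_mono) auto
        then show ?thesis
          by (simp add: norm_mult norm_power power_add power_divide mult_ac)
      qed
      have sums: "(\<lambda>m. C / R ^ Suc n * (norm q / R) ^ m) sums (C / R ^ Suc n * (1 / (1 - norm q / R)))"
        using R R0 by (intro sums_mult geometric_sums) auto
      have "norm (d n) \<le> (\<Sum>m. C / R ^ Suc n * (norm q / R) ^ m)"
        unfolding d_def qseries_def using bound sums by (intro norm_suminf_le) (auto simp: sums_iff)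
      also have "\<dots> = K * (1 / R) ^ n"
        using sums by (simp add: sums_iff K_def power_divide)
      finally show ?thesis .
    qed
    have "summable (\<lambda>n. K * (r / R) ^ n)"
      using r R R0 by (intro summable_mult summable_geometric) auto
    then show "summable (\<lambda>n. norm (d n) * r ^ n)"
    proof (rule summable_comparison_test' [where N = 0])
      show "norm (norm (d n) * r ^ n) \<le> K * (r / R) ^ n" for n
        using mult_right_mono [OF le [of n], of "r ^ n"] r by (simp add: power_divide)
    qed
  qed
qed

text \<open>Evaluation is not multiplicative: a further zero \<open>p\<close> of the product becomes a zero of the cofactor
  at a conjugate of \<open>p\<close>, which has the same norm.\<close>

lemma qseries_linear_factor:
  assumes c: "unit_radius c" and d: "unit_radius d" and p: "norm p < 1"
    and c0: "c 0 = - (q * d 0)" and cS: "\<And>n. c (Suc n) = d n - q * d (Suc n)" and ne: "p \<noteq> q"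
  shows "qseries c p = (p - q) * qseries d (inverse (p - q) * p * (p - q))"
proof -
  define T where "T = p - q"
  define p' where "p' = inverse T * p * T"
  have T: "T \<noteq> 0" using ne by (simp add: T_def)
  have np': "norm p' = norm p"
    using T by (simp add: p'_def norm_mult norm_inverse)
  have conj: "p ^ n * T = T * p' ^ n" for n
  proof (induction n)
    case (Suc n)
    have pT: "p * T = T * p'"
    proof -
      have "T * p' = (T * inverse T) * p * T" by (simp only: p'_def mult.assoc)
      then show ?thesis using T by simp
    qed
    have "p ^ Suc n * T = p * (p ^ n * T)" by (simp only: power_Suc mult.assoc)
    also have "\<dots> = (p * T) * p' ^ n" by (simp only: Suc.IH mult.assoc)
    also have "\<dots> = T * p' ^ Suc n" by (simp only: pT power_Suc mult.assoc)
    finally show ?case .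
  qed simp
  have s1: "(\<lambda>n. p * (p ^ n * d n)) sums (p * qseries d p)"
    by (intro sums_mult qseries_sums d p)
  have "summable (\<lambda>n. norm (p ^ n * (q * d n)))"
  proof -
    have "summable (\<lambda>n. norm q * norm (p ^ n * d n))"
      by (intro summable_mult qseries_abs_summable d p)
    then show ?thesis by (simp add: norm_mult mult_ac)
  qed
  from summable_norm_cancel [OF this] obtain Y where s2: "(\<lambda>n. p ^ n * (q * d n)) sums Y"
    by (auto simp: summable_def)
  have "(\<lambda>n. p ^ Suc n * (q * d (Suc n))) sums (Y - p ^ 0 * (q * d 0))"
    using s2 by (subst sums_Suc_iff) simp
  with s1 have "(\<lambda>n. p * (p ^ n * d n) - p ^ Suc n * (q * d (Suc n))) sums
      (p * qseries d p - (Y - p ^ 0 * (q * d 0)))"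
    by (rule sums_diff)
  then have "(\<lambda>n. p ^ Suc n * c (Suc n)) sums (p * qseries d p - (Y - q * d 0))"
    by (simp add: cS right_diff_distrib mult.assoc)
  then have "(\<lambda>n. p ^ n * c n) sums (p * qseries d p - (Y - q * d 0) + p ^ 0 * c 0)"
    by (rule sums_Suc)
  then have 1: "qseries c p = p * qseries d p - Y"
    using sums_unique2 [OF qseries_sums [OF c p]] by (simp add: c0)
  have "(\<lambda>n. p * (p ^ n * d n) - p ^ n * (q * d n)) sums (p * qseries d p - Y)"
    by (rule sums_diff [OF s1 s2])
  moreover have "p * (p ^ n * d n) - p ^ n * (q * d n) = T * (p' ^ n * d n)" for n
  proof -
    have "p * (p ^ n * d n) = p ^ n * (p * d n)"
      by (simp only: mult.assoc [symmetric] power_commutes)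
    then have "p * (p ^ n * d n) - p ^ n * (q * d n) = p ^ n * (T * d n)"
      by (simp add: T_def left_diff_distrib right_diff_distrib)
    also have "\<dots> = (p ^ n * T) * d n" by (simp only: mult.assoc)
    also have "\<dots> = T * (p' ^ n * d n)" by (simp only: conj mult.assoc)
    finally show ?thesis .
  qed
  ultimately have "(\<lambda>n. T * (p' ^ n * d n)) sums (p * qseries d p - Y)" by simp
  moreover have "(\<lambda>n. T * (p' ^ n * d n)) sums (T * qseries d p')"
    using np' p by (intro sums_mult qseries_sums d) simp
  ultimately have "p * qseries d p - Y = T * qseries d p'" by (rule sums_unique2)
  with 1 show ?thesis by (simp only: T_def p'_def)
qed

section \<open>The norm form of a power series\<close>

text \<open>The series \<open>\<Sum> z\<^sup>n c\<^sub>n\<close> at a central complex \<open>z\<close> is \<open>qre c z + \<i> qim c z\<close>.  The value at the point of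
  the slice of \<open>I\<close> corresponding to \<open>z\<close> arises by substituting \<open>I\<close> for \<open>\<i>\<close>.\<close>

definition qre :: "(nat \<Rightarrow> quat) \<Rightarrow> complex \<Rightarrow> quat" where
  "qre c z = (\<Sum>n. Re (z ^ n) *\<^sub>R c n)"

definition qim :: "(nat \<Rightarrow> quat) \<Rightarrow> complex \<Rightarrow> quat" where
  "qim c z = (\<Sum>n. Im (z ^ n) *\<^sub>R c n)"

lemma qre_sums:
  assumes c: "unit_radius c" and z: "norm z < 1"
  shows "(\<lambda>n. Re (z ^ n) *\<^sub>R c n) sums qre c z"
proof -
  have "summable (\<lambda>n. norm (c n) * norm z ^ n)"
    using c z by (simp add: unit_radius_def)
  then have "summable (\<lambda>n. Re (z ^ n) *\<^sub>R c n)"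
  proof (rule summable_comparison_test' [where N = 0])
    show "norm (Re (z ^ n) *\<^sub>R c n) \<le> norm (c n) * norm z ^ n" for n
      using mult_left_mono [OF abs_Re_le_cmod [of "z ^ n"], of "norm (c n)"]
      by (simp add: norm_power mult.commute)
  qed
  then show ?thesis by (simp add: qre_def summable_sums)
qed

lemma qim_sums:
  assumes c: "unit_radius c" and z: "norm z < 1"
  shows "(\<lambda>n. Im (z ^ n) *\<^sub>R c n) sums qim c z"
proof -
  have "summable (\<lambda>n. norm (c n) * norm z ^ n)"
    using c z by (simp add: unit_radius_def)
  then have "summable (\<lambda>n. Im (z ^ n) *\<^sub>R c n)"
  proof (rule summable_comparison_test' [where N = 0])
    show "norm (Im (z ^ n) *\<^sub>R c n) \<le> norm (c n) * norm z ^ n" for n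
      using mult_left_mono [OF abs_Im_le_cmod [of "z ^ n"], of "norm (c n)"]
      by (simp add: norm_power mult.commute)
  qed
  then show ?thesis by (simp add: qim_def summable_sums)
qed

lemma qseries_slice_embed:
  assumes c: "unit_radius c" and z: "norm z < 1" and I: "I \<in> \<S>"
  shows "qseries c (slice_embed I z) = qre c z + I * qim c z"
proof -
  have "(\<lambda>n. Re (z ^ n) *\<^sub>R c n + I * (Im (z ^ n) *\<^sub>R c n)) sums (qre c z + I * qim c z)"
    by (intro sums_add sums_mult qre_sums qim_sums c z)
  moreover have "Re (z ^ n) *\<^sub>R c n + I * (Im (z ^ n) *\<^sub>R c n) = slice_embed I z ^ n * c n" for n
    by (simp add: slice_embed_power [OF I] slice_embed_mult_eq)
  ultimately show ?thesis by (simp add: qseries_def sums_iff)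
qed

lemma qcoord_eq_Complex:
  assumes c: "unit_radius c" and z: "norm z < 1"
  shows "qcoord c e z = Complex (inner (qre c z) e) (inner (qim c z) e)"
proof (rule complex_eqI)
  have "(\<lambda>n. Re (of_real (inner (c n) e) * z ^ n)) sums Re (qcoord c e z)"
    "(\<lambda>n. Im (of_real (inner (c n) e) * z ^ n)) sums Im (qcoord c e z)"
    by (intro sums_Re sums_Im qcoord_sums c z)+
  moreover have "(\<lambda>n. inner (Re (z ^ n) *\<^sub>R c n) e) sums inner (qre c z) e"
    "(\<lambda>n. inner (Im (z ^ n) *\<^sub>R c n) e) sums inner (qim c z) e"
    by (intro bounded_linear.sums [OF bounded_linear_inner_left] qre_sums qim_sums c z)+
  ultimately show "Re (qcoord c e z) = Re (Complex (inner (qre c z) e) (inner (qim c z) e))"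
    "Im (qcoord c e z) = Im (Complex (inner (qre c z) e) (inner (qim c z) e))"
    by (auto simp: sums_iff mult.commute)
qed

text \<open>The norm form turns a quaternionic power series into a holomorphic function on the disc.\<close>

definition norm_form :: "(nat \<Rightarrow> quat) \<Rightarrow> complex \<Rightarrow> complex" where
  "norm_form c z = pair_form (qre c z) (qim c z)"

lemma norm_form_holomorphic:
  assumes c: "unit_radius c"
  shows "norm_form c holomorphic_on ball 0 1"
proof -
  have eq: "pair_form A B = (\<Sum>e\<in>Basis. (Complex (inner A e) (inner B e))\<^sup>2)" for A B
    by (simp add: Basis_quat_def pair_form_def complex_eq_iff norm_quat_squared inner_quat_def)
      (simp add: power2_eq_square)
  have "(\<lambda>z. \<Sum>e\<in>Basis. (qcoord c e z)\<^sup>2) holomorphic_on ball 0 1"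
    by (intro holomorphic_intros qcoord_holomorphic c)
  then show ?thesis
    by (rule holomorphic_transform) (simp add: norm_form_def eq qcoord_eq_Complex [OF c])
qed

lemma qre_0 [simp]: "qre c 0 = c 0" and qim_0 [simp]: "qim c 0 = 0"
proof -
  have "(\<lambda>n. Re (0 ^ n) *\<^sub>R c n) sums (\<Sum>n\<in>{0}. Re (0 ^ n) *\<^sub>R c n)"
    by (rule sums_finite) auto
  then show "qre c 0 = c 0" by (simp add: qre_def sums_iff)
  have "Im (0 ^ n) = 0" for n
    by (cases n) auto
  then show "qim c 0 = 0" by (simp add: qim_def)
qed

lemma norm_form_0: "norm_form c 0 = of_real ((norm (c 0))\<^sup>2)"
  by (simp add: norm_form_def pair_form_def complex_eq_iff)

lemma qre_qim_linear_factor: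
  assumes c: "unit_radius c" and d: "unit_radius d" and z: "norm z < 1"
    and c0: "c 0 = - (q * d 0)" and cS: "\<And>n. c (Suc n) = d n - q * d (Suc n)"
  shows "qre c z = Re z *\<^sub>R qre d z - Im z *\<^sub>R qim d z - q * qre d z"
    and "qim c z = Re z *\<^sub>R qim d z + Im z *\<^sub>R qre d z - q * qim d z"
proof -
  note re = qre_sums [OF d z] and im = qim_sums [OF d z]
  have re': "(\<lambda>n. q * (Re (z ^ Suc n) *\<^sub>R d (Suc n))) sums (q * (qre d z - d 0))"
    using re by (intro sums_mult) (subst sums_Suc_iff, simp)
  have im': "(\<lambda>n. q * (Im (z ^ Suc n) *\<^sub>R d (Suc n))) sums (q * (qim d z - 0))"
    using im by (intro sums_mult) (subst sums_Suc_iff, simp)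
  have "(\<lambda>n. Re z *\<^sub>R (Re (z ^ n) *\<^sub>R d n) - Im z *\<^sub>R (Im (z ^ n) *\<^sub>R d n)
      - q * (Re (z ^ Suc n) *\<^sub>R d (Suc n)))
      sums (Re z *\<^sub>R qre d z - Im z *\<^sub>R qim d z - q * (qre d z - d 0))"
    by (intro sums_diff sums_scaleR_right re im re')
  then have "(\<lambda>n. Re (z ^ Suc n) *\<^sub>R c (Suc n))
      sums (Re z *\<^sub>R qre d z - Im z *\<^sub>R qim d z - q * (qre d z - d 0))"
    by (simp add: cS scaleR_diff_left scaleR_diff_right right_diff_distrib)
  then have "(\<lambda>n. Re (z ^ n) *\<^sub>R c n)
      sums (Re z *\<^sub>R qre d z - Im z *\<^sub>R qim d z - q * (qre d z - d 0) + Re (z ^ 0) *\<^sub>R c 0)"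
    by (rule sums_Suc)
  then show "qre c z = Re z *\<^sub>R qre d z - Im z *\<^sub>R qim d z - q * qre d z"
    using sums_unique2 [OF qre_sums [OF c z]] by (simp add: c0 right_diff_distrib)
  have "(\<lambda>n. Re z *\<^sub>R (Im (z ^ n) *\<^sub>R d n) + Im z *\<^sub>R (Re (z ^ n) *\<^sub>R d n)
      - q * (Im (z ^ Suc n) *\<^sub>R d (Suc n)))
      sums (Re z *\<^sub>R qim d z + Im z *\<^sub>R qre d z - q * (qim d z - 0))"
    by (intro sums_diff sums_add sums_scaleR_right re im im')
  then have "(\<lambda>n. Im (z ^ Suc n) *\<^sub>R c (Suc n))
      sums (Re z *\<^sub>R qim d z + Im z *\<^sub>R qre d z - q * (qim d z - 0))"
    by (simp add: cS scaleR_diff_left scaleR_diff_right scaleR_add_left right_diff_distrib distrib_left)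
  then have "(\<lambda>n. Im (z ^ n) *\<^sub>R c n)
      sums (Re z *\<^sub>R qim d z + Im z *\<^sub>R qre d z - q * (qim d z - 0) + Im (z ^ 0) *\<^sub>R c 0)"
    by (rule sums_Suc)
  then show "qim c z = Re z *\<^sub>R qim d z + Im z *\<^sub>R qre d z - q * qim d z"
    using sums_unique2 [OF qim_sums [OF c z]] by (simp add: c0)
qed

lemma inner_mult_left_same: "inner (q * a) (q * b) = (norm q)\<^sup>2 * inner a (b :: quat)"
  unfolding norm_quat_squared inner_quat_def by (simp add: power2_eq_square algebra_simps)

lemma inner_mult_left_swap: "inner b (q * a) = 2 * qr q * inner a b - inner a (q * b :: quat)"
  by (simp add: inner_quat_def algebra_simps)

lemma pair_form_linear_factor:
  "pair_form (Re z *\<^sub>R A - Im z *\<^sub>R B - q * A) (Re z *\<^sub>R B + Im z *\<^sub>R A - q * B)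
    = (z\<^sup>2 - of_real (2 * qr q) * z + of_real ((norm q)\<^sup>2)) * pair_form A B"
proof -
  have self: "inner a (q * a) = qr q * inner a a" "inner (q * a) a = qr q * inner a a" for a
    by (simp_all add: inner_quat_def algebra_simps)
  have flip: "inner (q * a) b = inner b (q * a)" for a b
    by (rule inner_commute)
  show ?thesis
    unfolding pair_form_def complex_eq_iff power2_norm_eq_inner [of A] power2_norm_eq_inner [of B]
      power2_norm_eq_inner [of "Re z *\<^sub>R A - Im z *\<^sub>R B - q * A"]
      power2_norm_eq_inner [of "Re z *\<^sub>R B + Im z *\<^sub>R A - q * B"]
    by (simp add: inner_add_left inner_add_right inner_diff_left inner_diff_right self
        inner_mult_left_same flip [of A B] flip [of B A] inner_mult_left_swap [of B q A]
        inner_commute [of B A])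
      (simp add: power2_eq_square algebra_simps)
qed

lemma quadratic_factor:
  obtains \<zeta> where "norm \<zeta> = norm q"
    "\<And>z. z\<^sup>2 - of_real (2 * qr q) * z + of_real ((norm q)\<^sup>2) = (z - \<zeta>) * (z - cnj \<zeta>)"
proof
  define y where "y = sqrt ((qi q)\<^sup>2 + (qj q)\<^sup>2 + (qk q)\<^sup>2)"
  have y2: "(qr q)\<^sup>2 + y\<^sup>2 = (norm q)\<^sup>2"
    by (simp add: y_def norm_quat_squared)
  then show "norm (Complex (qr q) y) = norm q"
    by (simp add: complex_norm)
  show "z\<^sup>2 - of_real (2 * qr q) * z + of_real ((norm q)\<^sup>2)
      = (z - Complex (qr q) y) * (z - cnj (Complex (qr q) y))" for z
    unfolding y2 [symmetric] by (simp add: complex_eq_iff power2_eq_square algebra_simps)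
qed

lemma norm_form_linear_factor:
  assumes "unit_radius c" "unit_radius d" "norm z < 1"
    and "c 0 = - (q * d 0)" "\<And>n. c (Suc n) = d n - q * d (Suc n)"
  shows "norm_form c z = (z\<^sup>2 - of_real (2 * qr q) * z + of_real ((norm q)\<^sup>2)) * norm_form d z"
  using qre_qim_linear_factor [of c d z q, OF assms]
  by (simp add: norm_form_def pair_form_linear_factor)

section \<open>Two points with the same value\<close>

text \<open>The Moebius transform of the series with respect to the common value \<open>w\<close> has a determinant that is
  bounded by one and has modulus \<open>w\<^sup>2 / N\<^sup>2\<close> at the origin.  Two quaternionic linear factors split off,
  and each contributes a pair of conjugate zeros of modulus \<open>|q1|\<close> or \<open>|q2|\<close> to the determinant.\<close>

lemma two_point_real_value:
  fixes N w :: real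
  assumes b: "unit_radius b" and b0: "b 0 = 0"
    and bound: "\<And>q. norm q < 1 \<Longrightarrow> norm (qseries b q) \<le> N"
    and q: "norm q1 < 1" "norm q2 < 1" "q1 \<noteq> q2"
    and eq: "qseries b q1 = of_real w" "qseries b q2 = of_real w" and w: "0 \<le> w" "w < N"
  shows "w \<le> N * (norm q1 * norm q2)"
proof -
  \<comment> \<open>\<open>c\<close> and \<open>c'\<close> are the coefficients of \<open>f - w\<close> and \<open>N\<^sup>2 - w f\<close>, for \<open>f\<close> the sum of \<open>b\<close>.\<close>
  define c where "c n = (if n = 0 then - of_real w else b n)" for n
  define c' where "c' n = (if n = 0 then of_real (N\<^sup>2) else - (w *\<^sub>R b n))" for n
  have c: "unit_radius c"
    by (rule unit_radius_change_0 [OF b, of _ 1]) (simp add: c_def)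
  have c': "unit_radius c'"
    by (rule unit_radius_change_0 [OF b, of _ w]) (use w in \<open>simp add: c'_def\<close>)
  have cS: "c (Suc n) = b (Suc n)" "c' (Suc n) = - (w *\<^sub>R b (Suc n))" for n
    by (simp_all add: c_def c'_def)
  have qser: "qseries c p = qseries b p - of_real w" if "norm p < 1" for p
    using qseries_Suc [OF c that] qseries_Suc [OF b that] by (simp add: cS b0) (simp add: c_def)
  have re: "qre c z = qre b z - of_real w" "qre c' z = of_real (N\<^sup>2) - w *\<^sub>R qre b z"
    and im: "qim c z = qim b z" "qim c' z = - (w *\<^sub>R qim b z)" if z: "norm z < 1" for z
  proof -
    have single: "(\<lambda>n. if n = 0 then a else 0) sums a" for a :: quat
      using sums_single [of 0 "\<lambda>_. a"] by (simp cong: if_cong)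
    have "(\<lambda>n. Re (z ^ n) *\<^sub>R b n - (if n = 0 then of_real w else 0)) sums (qre b z - of_real w)"
      by (intro sums_diff qre_sums b z single)
    moreover have "Re (z ^ n) *\<^sub>R b n - (if n = 0 then of_real w else 0) = Re (z ^ n) *\<^sub>R c n" for n
      by (simp add: c_def b0)
    ultimately show "qre c z = qre b z - of_real w"
      using qre_sums [OF c z] by (simp add: sums_iff)
    have "(\<lambda>n. (if n = 0 then of_real (N\<^sup>2) else 0) - w *\<^sub>R (Re (z ^ n) *\<^sub>R b n))
        sums (of_real (N\<^sup>2) - w *\<^sub>R qre b z)"
      by (intro sums_diff sums_scaleR_right qre_sums b z single)
    moreover have "(if n = 0 then of_real (N\<^sup>2) else 0) - w *\<^sub>R (Re (z ^ n) *\<^sub>R b n) = Re (z ^ n) *\<^sub>R c' n" for n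
      by (simp add: c'_def b0)
    ultimately show "qre c' z = of_real (N\<^sup>2) - w *\<^sub>R qre b z"
      using qre_sums [OF c' z] by (simp add: sums_iff)
    have "(\<lambda>n. Im (z ^ n) *\<^sub>R b n) = (\<lambda>n. Im (z ^ n) *\<^sub>R c n)"
      by (auto simp: c_def b0)
    then show "qim c z = qim b z" by (simp add: qim_def)
    have "(\<lambda>n. - (w *\<^sub>R (Im (z ^ n) *\<^sub>R b n))) sums (- (w *\<^sub>R qim b z))"
      by (intro sums_minus sums_scaleR_right qim_sums b z)
    moreover have "- (w *\<^sub>R (Im (z ^ n) *\<^sub>R b n)) = Im (z ^ n) *\<^sub>R c' n" for n
      by (simp add: c'_def b0)
    ultimately show "qim c' z = - (w *\<^sub>R qim b z)"
      using qim_sums [OF c' z] by (simp add: sums_iff)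
  qed
  have slice: "norm (qre b z + I * qim b z) \<le> N" if "norm z < 1" "I \<in> \<S>" for z I
    using bound [of "slice_embed I z"] that by (simp add: qseries_slice_embed [OF b])
  have form: "N\<^sup>2 * norm (norm_form c z) \<le> norm (norm_form c' z)" "norm_form c' z \<noteq> 0"
    if "norm z < 1" for z
    unfolding norm_form_def re [OF that] im [OF that]
    by (rule pair_form_moebius [OF slice [OF that] w], assumption)+
  obtain d where d: "unit_radius d" "c 0 = - (q1 * d 0)" "\<And>n. c (Suc n) = d n - q1 * d (Suc n)"
    using qseries_divide_linear [OF c q(1)] qser [OF q(1)] eq by auto
  define q2' where "q2' = inverse (q2 - q1) * q2 * (q2 - q1)"
  have nq2': "norm q2' = norm q2"
    using q by (simp add: q2'_def norm_mult norm_inverse)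
  have "qseries d q2' = 0"
    using qseries_linear_factor [of c d q2 q1, OF c d(1) q(2) d(2,3)] q qser [OF q(2)] eq
    by (simp add: q2'_def)
  then obtain k where k: "unit_radius k" "d 0 = - (q2' * k 0)" "\<And>n. d (Suc n) = k n - q2' * k (Suc n)"
    using qseries_divide_linear [OF d(1), of q2'] q nq2' by auto
  obtain \<zeta>1 where \<zeta>1: "norm \<zeta>1 = norm q1"
    "\<And>z. z\<^sup>2 - of_real (2 * qr q1) * z + of_real ((norm q1)\<^sup>2) = (z - \<zeta>1) * (z - cnj \<zeta>1)"
    using quadratic_factor [of q1] by blast
  obtain \<zeta>2 where \<zeta>2: "norm \<zeta>2 = norm q2'"
    "\<And>z. z\<^sup>2 - of_real (2 * qr q2') * z + of_real ((norm q2')\<^sup>2) = (z - \<zeta>2) * (z - cnj \<zeta>2)"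
    using quadratic_factor [of q2'] by blast
  have factor: "norm_form c z = (z - \<zeta>1) * ((z - cnj \<zeta>1) * ((z - \<zeta>2) * ((z - cnj \<zeta>2) * norm_form k z)))"
    if z: "norm z < 1" for z
    using norm_form_linear_factor [of c d z q1, OF c d(1) z d(2,3)]
      norm_form_linear_factor [of d k z q2', OF d(1) k(1) z k(2,3)]
    by (simp only: \<zeta>1(2) \<zeta>2(2) mult.assoc)
  define \<psi> where "\<psi> z = of_real (N\<^sup>2) * norm_form k z / norm_form c' z" for z
  have hol: "\<psi> holomorphic_on ball 0 1"
    unfolding \<psi>_def using form(2) by (intro holomorphic_intros norm_form_holomorphic k c') auto
  have s0: "norm ((z - \<zeta>1) * ((z - cnj \<zeta>1) * ((z - \<zeta>2) * ((z - cnj \<zeta>2) * \<psi> z)))) \<le> 1"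
    if z: "norm z < 1" for z
  proof -
    have "(z - \<zeta>1) * ((z - cnj \<zeta>1) * ((z - \<zeta>2) * ((z - cnj \<zeta>2) * \<psi> z)))
        = of_real (N\<^sup>2) * norm_form c z / norm_form c' z"
      by (simp add: \<psi>_def factor [OF z] mult_ac)
    then show ?thesis
      using form [OF z] by (simp add: norm_mult norm_divide norm_power)
  qed
  have n1: "norm \<zeta>1 < 1" "norm (cnj \<zeta>1) < 1" "norm \<zeta>2 < 1" "norm (cnj \<zeta>2) < 1"
    using \<zeta>1(1) \<zeta>2(1) nq2' q by simp_all
  have s1: "norm ((z - cnj \<zeta>1) * ((1 - cnj \<zeta>1 * z) * ((z - \<zeta>2) * ((z - cnj \<zeta>2) * \<psi> z)))) \<le> 1"
    if z: "norm z < 1" for z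
  proof -
    have "(\<lambda>z. (z - cnj \<zeta>1) * ((z - \<zeta>2) * ((z - cnj \<zeta>2) * \<psi> z))) holomorphic_on ball 0 1"
      by (intro holomorphic_intros hol)
    from blaschke_factor_removal [OF this n1(1) s0 z] show ?thesis by (simp add: mult_ac)
  qed
  have s2: "norm ((z - \<zeta>2) * ((1 - \<zeta>1 * z) * ((1 - cnj \<zeta>1 * z) * ((z - cnj \<zeta>2) * \<psi> z)))) \<le> 1"
    if z: "norm z < 1" for z
  proof -
    have "(\<lambda>z. (1 - cnj \<zeta>1 * z) * ((z - \<zeta>2) * ((z - cnj \<zeta>2) * \<psi> z))) holomorphic_on ball 0 1"
      by (intro holomorphic_intros hol)
    from blaschke_factor_removal [OF this n1(2) s1 z] show ?thesis by (simp add: mult_ac)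
  qed
  have s3: "norm ((z - cnj \<zeta>2) * ((1 - cnj \<zeta>2 * z) * ((1 - \<zeta>1 * z) * ((1 - cnj \<zeta>1 * z) * \<psi> z)))) \<le> 1"
    if z: "norm z < 1" for z
  proof -
    have "(\<lambda>z. (1 - \<zeta>1 * z) * ((1 - cnj \<zeta>1 * z) * ((z - cnj \<zeta>2) * \<psi> z))) holomorphic_on ball 0 1"
      by (intro holomorphic_intros hol)
    from blaschke_factor_removal [OF this n1(3) s2 z] show ?thesis by (simp add: mult_ac)
  qed
  have "norm (\<psi> 0) \<le> 1"
  proof -
    have "(\<lambda>z. (1 - cnj \<zeta>2 * z) * ((1 - \<zeta>1 * z) * ((1 - cnj \<zeta>1 * z) * \<psi> z))) holomorphic_on ball 0 1"
      by (intro holomorphic_intros hol)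
    from blaschke_factor_removal [OF this n1(4) s3, of 0] show ?thesis by simp
  qed
  have N: "0 < N" using w by linarith
  have "c 0 = - of_real w" "c' 0 = of_real (N\<^sup>2)" by (simp_all add: c_def c'_def)
  then have at0: "norm_form c 0 = of_real (w\<^sup>2)" "norm_form c' 0 = of_real (N ^ 4)"
    by (simp_all add: norm_form_0 norm_power)
  have "w\<^sup>2 = norm (norm_form c 0)" unfolding at0 norm_of_real by simp
  also have "\<dots> = (norm q1)\<^sup>2 * (norm q2)\<^sup>2 * norm (norm_form k 0)"
    using factor [of 0] \<zeta>1(1) \<zeta>2(1) nq2' by (simp add: norm_mult power2_eq_square mult_ac)
  also have "\<dots> \<le> (norm q1)\<^sup>2 * (norm q2)\<^sup>2 * N\<^sup>2"
  proof (rule mult_left_mono)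
    have "N\<^sup>2 * norm (norm_form k 0) / N ^ 4 \<le> 1"
      using \<open>norm (\<psi> 0) \<le> 1\<close> N unfolding \<psi>_def at0 by (simp add: norm_mult norm_divide norm_power)
    then have "N\<^sup>2 * norm (norm_form k 0) \<le> N\<^sup>2 * N\<^sup>2"
      using N by (simp add: pos_divide_le_eq)
    then show "norm (norm_form k 0) \<le> N\<^sup>2"
      by (rule mult_left_le_imp_le) (use N in simp)
  qed simp
  also have "\<dots> = (N * (norm q1 * norm q2))\<^sup>2" by (simp add: power_mult_distrib mult_ac)
  finally show ?thesis
    using N by (rule_tac power2_le_imp_le) auto
qed

lemma qseries_mult_right:
  assumes "unit_radius b" "norm q < 1"
  shows "qseries (\<lambda>n. b n * u) q = qseries b q * u"
proof -
  have "(\<lambda>n. (q ^ n * b n) * u) sums (qseries b q * u)"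
    by (intro sums_mult2 qseries_sums assms)
  then show ?thesis by (simp add: qseries_def sums_iff mult.assoc)
qed

lemma two_point:
  assumes b: "unit_radius b" and b0: "b 0 = 0"
    and bound: "\<And>q. norm q < 1 \<Longrightarrow> norm (qseries b q) \<le> N"
    and q: "norm q1 < 1" "norm q2 < 1" "q1 \<noteq> q2"
    and eq: "qseries b q1 = qseries b q2" and lt: "norm (qseries b q1) < N"
  shows "norm (qseries b q1) \<le> N * (norm q1 * norm q2)"
proof (cases "qseries b q1 = 0")
  case True
  then show ?thesis using lt by simp
next
  case False
  define W where "W = qseries b q1"
  \<comment> \<open>Multiplication of all coefficients by a unit on the right makes the common value real.\<close>
  define u where "u = qcnj W /\<^sub>R norm W"
  have W: "W \<noteq> 0" using False by (simp add: W_def)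
  have nu: "norm u = 1" using W by (simp add: u_def)
  have Wu: "W * u = of_real (norm W)"
  proof -
    have "W * u = (W * qcnj W) /\<^sub>R norm W" by (simp only: u_def mult_scaleR_right)
    also have "\<dots> = of_real (norm W)"
      using W by (simp add: mult_qcnj of_real_def power2_eq_square)
    finally show ?thesis .
  qed
  have bu: "unit_radius (\<lambda>n. b n * u)"
    by (rule unit_radius_norm_le [OF b, of _ 1]) (simp add: norm_mult nu)
  have "norm W \<le> N * (norm q1 * norm q2)"
  proof (rule two_point_real_value [OF bu])
    show "norm (qseries (\<lambda>n. b n * u) q) \<le> N" if "norm q < 1" for q
      using bound [OF that] by (simp add: qseries_mult_right [OF b that] norm_mult nu)
    show "qseries (\<lambda>n. b n * u) q1 = of_real (norm W)" "qseries (\<lambda>n. b n * u) q2 = of_real (norm W)"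
      using eq Wu by (simp_all add: qseries_mult_right [OF b] q W_def)
  qed (use q b0 lt in \<open>auto simp: W_def\<close>)
  then show ?thesis by (simp add: W_def)
qed

section \<open>Growth of bounded series\<close>

text \<open>The Schwarz lemma for the quotient \<open>q\<^sup>-\<^sup>1 f(q)\<close>.\<close>

lemma quotient_bound:
  assumes b: "unit_radius b" and b0: "b 0 = 0"
    and bound: "\<And>q. norm q < 1 \<Longrightarrow> norm (qseries b q) \<le> N" and q: "norm q < 1"
  shows "norm (qseries (\<lambda>n. b (Suc n)) q) \<le> N"
proof -
  define h where "h = qseries (\<lambda>n. b (Suc n))"
  have h: "qseries b p = p * h p" if "norm p < 1" for p
    using qseries_Suc [OF b that] by (simp add: b0 h_def)
  obtain I z where I: "I \<in> \<S>" and qz: "q = slice_embed I z"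
    using slice_embed_exists .
  have z: "norm z < 1" using q qz I by simp
  \<comment> \<open>The slice component of \<open>h\<close> in the direction \<open>h q\<close> attains the modulus of \<open>h q\<close> squared there.\<close>
  define e where "e = h q"
  define u where "u = slice_component h I e"
  have hol: "u holomorphic_on ball 0 1"
    unfolding u_def h_def by (intro slice_component_qseries_holomorphic I unit_radius_Suc b)
  have prod: "slice_component (qseries b) I e x = x * u x" if "norm x < 1" for x
  proof -
    have x: "norm (slice_embed I x) < 1" using that I by simp
    have "I * (I * e) = - e" using unit_square [OF I] by (simp add: mult.assoc [symmetric])
    then show ?thesis
      using inner_unit_mult_left [OF I, of _ e] inner_unit_mult_left [OF I, of _ "I * e"]
      by (simp add: slice_component_def u_def h [OF x] slice_embed_mult_eq inner_add_left
          complex_eq_iff)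
  qed
  have "norm ((1 - cnj 0 * z) * u z) \<le> N * norm e"
  proof (rule blaschke_factor_removal [OF hol _ _ z])
    fix x :: complex assume x: "norm x < 1"
    have "norm ((x - 0) * u x) \<le> norm (qseries b (slice_embed I x)) * norm e"
      using norm_slice_component_le [OF I, of "qseries b" e x] prod [OF x] by simp
    also have "\<dots> \<le> N * norm e"
      using bound [of "slice_embed I x"] x I by (simp add: mult_right_mono)
    finally show "norm ((x - 0) * u x) \<le> N * norm e" .
  qed simp
  moreover have "Re (u z) = norm e * norm e"
    by (simp add: u_def slice_component_def qz [symmetric] e_def [symmetric]
        power2_norm_eq_inner [symmetric] power2_eq_square [symmetric])
  ultimately have "norm e * norm e \<le> N * norm e"
    using complex_Re_le_cmod [of "u z"] by simp
  moreover have "0 \<le> N"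
    using bound [OF q] norm_ge_zero order_trans by blast
  ultimately have "norm e \<le> N" by (cases "e = 0") auto
  then show ?thesis by (simp add: e_def h_def)
qed

text \<open>The hypothesis is the squared Schwarz-Pick inequality \<open>N |u - 1| \<le> s |N\<^sup>2 - u|\<close> for a complex \<open>u\<close> of
  modulus \<open>t\<close> and real part \<open>x\<close>; for fixed \<open>t\<close> the least restrictive case is \<open>x = t\<close>.\<close>

lemma schwarz_pick_lower:
  fixes N s x t :: real
  assumes "1 < N" "x \<le> t" "0 \<le> t" "t < 1" "0 \<le> s"
    and le: "N\<^sup>2 * (t\<^sup>2 - 2 * x + 1) \<le> s\<^sup>2 * (N ^ 4 - 2 * N\<^sup>2 * x + t\<^sup>2)"
  shows "N * (1 - t) \<le> s * (N\<^sup>2 - t)"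
proof -
  define E where "E = N ^ 4 - 2 * N\<^sup>2 * x + t\<^sup>2"
  have ge: "N * (1 - t) \<le> N\<^sup>2 - t"
  proof -
    have "0 \<le> (N - 1) * (N + t)" using assms by simp
    then show ?thesis by (simp add: power2_eq_square algebra_simps)
  qed
  have pos: "0 < N\<^sup>2 - t"
  proof -
    have "1 < N\<^sup>2" using assms by (simp add: one_less_power)
    then show ?thesis using assms by linarith
  qed
  have E: "0 < E"
  proof -
    have "E = (N\<^sup>2 - t)\<^sup>2 + 2 * N\<^sup>2 * (t - x)"
      by (simp add: E_def power2_eq_square power4_eq_xxxx algebra_simps)
    moreover have "0 \<le> 2 * N\<^sup>2 * (t - x)" using assms by simp
    moreover have "0 < (N\<^sup>2 - t)\<^sup>2" using pos by simp
    ultimately show ?thesis by linarith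
  qed
  have "(N * (1 - t))\<^sup>2 \<le> (N\<^sup>2 - t)\<^sup>2"
    using ge assms by (intro power_mono) auto
  then have "0 \<le> 2 * (t - x) * ((N\<^sup>2 - t)\<^sup>2 - (N * (1 - t))\<^sup>2)"
    using assms by simp
  also have "\<dots> = (N\<^sup>2 - t)\<^sup>2 * (t\<^sup>2 - 2 * x + 1) - (1 - t)\<^sup>2 * E"
    by (simp add: E_def power2_eq_square power4_eq_xxxx algebra_simps)
  finally have "N\<^sup>2 * ((1 - t)\<^sup>2 * E) \<le> N\<^sup>2 * ((N\<^sup>2 - t)\<^sup>2 * (t\<^sup>2 - 2 * x + 1))"
    by (intro mult_left_mono) auto
  also have "\<dots> = (N\<^sup>2 - t)\<^sup>2 * (N\<^sup>2 * (t\<^sup>2 - 2 * x + 1))" by simp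
  also have "\<dots> \<le> (N\<^sup>2 - t)\<^sup>2 * (s\<^sup>2 * E)"
    unfolding E_def by (intro mult_left_mono le) auto
  finally have "(N * (1 - t))\<^sup>2 * E \<le> (s * (N\<^sup>2 - t))\<^sup>2 * E"
    by (simp add: power_mult_distrib mult_ac)
  then have "(N * (1 - t))\<^sup>2 \<le> (s * (N\<^sup>2 - t))\<^sup>2" using E by simp
  then show ?thesis
    using pos assms by (rule_tac power2_le_imp_le) auto
qed

text \<open>Schwarz-Pick for the slice component of \<open>q\<^sup>-\<^sup>1 f(q)\<close> in the direction \<open>1\<close>, which takes the value \<open>1\<close> at
  the origin.\<close>

lemma quotient_lower_bound:
  assumes b: "unit_radius b" and b0: "b 0 = 0" and b1: "b 1 = 1" and N: "1 < N"
    and bound: "\<And>q. norm q < 1 \<Longrightarrow> norm (qseries b q) \<le> N" and q: "norm q < 1"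
  shows "N * (1 - norm (qseries (\<lambda>n. b (Suc n)) q))
    \<le> norm q * (N\<^sup>2 - norm (qseries (\<lambda>n. b (Suc n)) q))"
proof -
  define h where "h = qseries (\<lambda>n. b (Suc n))"
  obtain I z where I: "I \<in> \<S>" and qz: "q = slice_embed I z"
    using slice_embed_exists .
  have z: "norm z < 1" and nz: "norm z = norm q" using q qz I by simp_all
  define u where "u = slice_component h I 1"
  have hol: "u holomorphic_on ball 0 1"
    unfolding u_def h_def by (intro slice_component_qseries_holomorphic I unit_radius_Suc b)
  have u0: "u 0 = 1"
  proof -
    have "qr I = 0" using I by (simp add: imag_unit_sphere_iff)
    then show ?thesis
      using b1 by (simp add: u_def slice_component_def h_def complex_eq_iff inner_quat_def)
  qed
  have un: "norm (u x) \<le> norm (h (slice_embed I x))" for x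
    using norm_slice_component_le [OF I, of h 1 x] by (simp add: u_def)
  have uN: "norm (u x) \<le> N" if "norm x < 1" for x
    using un [of x] quotient_bound [OF b b0 bound, of "slice_embed I x"] that I
    by (simp add: h_def)
  have N2: "N < N\<^sup>2" using N by (simp add: power2_eq_square)
  have ne: "of_real (N\<^sup>2) - u x \<noteq> 0" if "norm x < 1" for x
  proof
    assume "of_real (N\<^sup>2) - u x = 0"
    then have "u x = of_real (N\<^sup>2)" by simp
    then have "norm (u x) = N\<^sup>2" by (simp only: norm_of_real) simp
    with uN [OF that] N2 show False by simp
  qed
  define m where "m x = of_real N * (u x - 1) / (of_real (N\<^sup>2) - u x)" for x
  have holm: "m holomorphic_on ball 0 1"
    unfolding m_def using ne by (intro holomorphic_intros hol) auto
  obtain \<psi> where hol\<psi>: "\<psi> holomorphic_on ball 0 1" and m\<psi>: "\<And>x. norm x < 1 \<Longrightarrow> m x = x * \<psi> x"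
    using Schwarz3 [OF holm] by (auto simp: m_def u0)
  have "norm ((1 - cnj 0 * z) * \<psi> z) \<le> 1"
  proof (rule blaschke_factor_removal [OF hol\<psi> _ _ z])
    fix x :: complex assume x: "norm x < 1"
    have "N * norm (u x - 1) \<le> norm (of_real (N\<^sup>2) - u x)"
      using norm_moebius_le [OF norm_one uN [OF x], of 1] N by (simp add: scaleR_conv_of_real)
    then have "norm (m x) \<le> 1"
      using N ne [OF x] by (simp add: m_def norm_mult norm_divide)
    then show "norm ((x - 0) * \<psi> x) \<le> 1" by (simp add: m\<psi> [OF x])
  qed simp
  then have "norm (m z) \<le> norm q"
    using nz by (simp add: m\<psi> [OF z] norm_mult mult_left_le)
  then have le: "N * norm (u z - 1) \<le> norm q * norm (of_real (N\<^sup>2) - u z)"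
    using N ne [OF z] by (simp add: m_def norm_mult norm_divide pos_divide_le_eq)
  define t where "t = norm (u z)"
  have "N * (1 - t) \<le> norm q * (N\<^sup>2 - t)"
  proof (cases "t < 1")
    case True
    have "(N * norm (u z - 1))\<^sup>2 \<le> (norm q * norm (of_real (N\<^sup>2) - u z))\<^sup>2"
      using le N by (intro power_mono) auto
    moreover have "(norm (u z - 1))\<^sup>2 = t\<^sup>2 - 2 * Re (u z) + 1"
      "(norm (of_real (N\<^sup>2) - u z))\<^sup>2 = N ^ 4 - 2 * N\<^sup>2 * Re (u z) + t\<^sup>2"
      unfolding t_def cmod_power2 by (simp_all add: power2_eq_square power4_eq_xxxx algebra_simps)
    ultimately have "N\<^sup>2 * (t\<^sup>2 - 2 * Re (u z) + 1) \<le> (norm q)\<^sup>2 * (N ^ 4 - 2 * N\<^sup>2 * Re (u z) + t\<^sup>2)"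
      by (simp only: power_mult_distrib)
    with N True show ?thesis
      by (intro schwarz_pick_lower) (auto simp: t_def complex_Re_le_cmod)
  next
    case False
    moreover have "t \<le> N\<^sup>2" using uN [OF z] N2 by (simp add: t_def)
    ultimately have "N * (1 - t) \<le> 0" "0 \<le> norm q * (N\<^sup>2 - t)"
      using N by (simp_all add: mult_le_0_iff)
    then show ?thesis by linarith
  qed
  moreover have "0 \<le> (norm (h q) - t) * (N - norm q)"
    using un [of z] q N by (simp add: t_def qz)
  ultimately show ?thesis
    unfolding h_def [symmetric] by (simp add: algebra_simps)
qed

lemma growth:
  assumes b: "unit_radius b" and b0: "b 0 = 0" and b1: "b 1 = 1" and N: "1 < N"
    and bound: "\<And>q. norm q < 1 \<Longrightarrow> norm (qseries b q) \<le> N" and q: "norm q < 1"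
  shows "norm (qseries b q) \<le> N * norm q"
    and "N * norm q * (1 - N * norm q) \<le> norm (qseries b q) * (N - norm q)"
proof -
  define h where "h = qseries (\<lambda>n. b (Suc n)) q"
  have f: "norm (qseries b q) = norm q * norm h"
    using qseries_Suc [OF b q] by (simp add: b0 h_def norm_mult)
  show "norm (qseries b q) \<le> N * norm q"
    using mult_left_mono [OF quotient_bound [OF b b0 bound q], of "norm q"] unfolding f h_def
    by (simp add: mult.commute)
  have "N * (1 - N * norm q) \<le> norm h * (N - norm q)"
    using quotient_lower_bound [OF b b0 b1 N bound q] unfolding h_def [symmetric]
    by (simp add: power2_eq_square algebra_simps)
  then have "norm q * (N * (1 - N * norm q)) \<le> norm q * (norm h * (N - norm q))"
    by (rule mult_left_mono) simp
  then show "N * norm q * (1 - N * norm q) \<le> norm (qseries b q) * (N - norm q)"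
    unfolding f by (simp add: mult_ac)
qed

section \<open>The Landau and Bloch theorem for bounded series\<close>

text \<open>The image of the open ball is open by invariance of domain, and closed within the ball of radius
  \<open>|w|\<close>, which is connected.\<close>

lemma injective_ball_image_covers:
  fixes f :: "'a :: euclidean_space \<Rightarrow> 'a"
  assumes cont: "continuous_on (cball 0 s) f" and inj: "inj_on f (cball 0 s)" and s: "0 < s"
    and f0: "f 0 = 0" and sphere: "\<And>x. norm x = s \<Longrightarrow> norm w < norm (f x)"
  shows "w \<in> f ` ball 0 s"
proof -
  define C where "C = cball (0::'a) (norm w)"
  have eq: "C \<inter> f ` ball 0 s = C \<inter> f ` cball 0 s"
  proof
    show "C \<inter> f ` cball 0 s \<subseteq> C \<inter> f ` ball 0 s"
    proof
      fix y assume "y \<in> C \<inter> f ` cball 0 s"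
      then obtain x where x: "y = f x" "norm x \<le> s" "norm y \<le> norm w" by (auto simp: C_def)
      then have "norm x \<noteq> s" using sphere by force
      with x show "y \<in> C \<inter> f ` ball 0 s" by (auto simp: C_def)
    qed
  qed auto
  have "open (f ` ball 0 s)"
    using invariance_of_domain_ball [OF cont s inj] .
  then have op: "openin (top_of_set C) (C \<inter> f ` ball 0 s)"
    by (simp add: openin_open_Int)
  have "closed (f ` cball 0 s)"
    using compact_continuous_image [OF cont] compact_imp_closed by auto
  then have "closedin (top_of_set C) (C \<inter> f ` ball 0 s)"
    unfolding eq by (simp add: closedin_closed_Int)
  moreover have "connected C" by (simp add: C_def)
  moreover have "0 \<in> C \<inter> f ` ball 0 s"
  proof
    show "0 \<in> f ` ball 0 s" using f0 s by (intro image_eqI [of _ _ 0]) auto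
  qed (simp add: C_def)
  ultimately have "C \<inter> f ` ball 0 s = C"
    using op connected_clopen by blast
  then show ?thesis by (auto simp: C_def)
qed

text \<open>With \<open>s = |q2|\<close> the larger radius, the two-point bound and the lower growth bound combine to
  \<open>1 - N s \<le> s (N - s)\<close>, that is, \<open>s\<^sup>2 - 2 N s + 1 \<le> 0\<close>, which fails for
  \<open>s < \<rho>\<close>.\<close>

lemma landau_bloch_series:
  fixes N :: real
  assumes b: "unit_radius b" and b0: "b 0 = 0" and b1: "b 1 = 1" and N: "1 < N"
    and bound: "\<And>q. norm q < 1 \<Longrightarrow> norm (qseries b q) \<le> N"
  defines "\<rho> \<equiv> N - sqrt (N\<^sup>2 - 1)"
  shows "inj_on (qseries b) (ball 0 \<rho>)"
    and "ball 0 (N * \<rho>\<^sup>2) \<subseteq> qseries b ` ball 0 \<rho>"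
proof -
  define D where "D = sqrt (N\<^sup>2 - 1)"
  have N2: "1 < N\<^sup>2" using N by (simp add: one_less_power)
  then have D2: "D\<^sup>2 = N\<^sup>2 - 1" and D0: "0 < D" by (simp_all add: D_def)
  have \<rho>: "\<rho> = N - D" by (simp add: \<rho>_def D_def)
  have DN: "D < N"
    using D2 N D0 by (intro power2_less_imp_less [of D N]) auto
  have ND: "N - 1 < D"
  proof (rule power2_less_imp_less)
    show "(N - 1)\<^sup>2 < D\<^sup>2" unfolding D2 using N by (simp add: power2_eq_square algebra_simps)
  qed (use D0 in simp)
  have \<rho>01: "0 < \<rho>" "\<rho> < 1" using DN ND by (simp_all add: \<rho>)
  have root: "\<rho> * (N - \<rho>) = 1 - N * \<rho>"
    using D2 by (simp add: \<rho> power2_eq_square algebra_simps)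
  have quad: "s * (N - s) < 1 - N * s" if "s < \<rho>" for s
  proof -
    have "0 < (\<rho> - s) * (N + D - s)" using that D0 by (intro mult_pos_pos) (auto simp: \<rho>)
    also have "\<dots> = 1 - 2 * N * s + s\<^sup>2"
      using D2 by (simp add: \<rho> power2_eq_square algebra_simps)
    finally show ?thesis by (simp add: power2_eq_square algebra_simps)
  qed
  note up = growth(1) [OF b b0 b1 N bound] and low = growth(2) [OF b b0 b1 N bound]
  have aux: False
    if q: "norm q1 \<le> norm q2" "norm q2 < \<rho>" "q1 \<noteq> q2" and eq: "qseries b q1 = qseries b q2" for q1 q2
  proof -
    define s where "s = norm q2"
    have s: "0 < s" "s < \<rho>" "s < N" using q \<rho>01 N by (auto simp: s_def)
    have "norm (qseries b q1) < N"
      using up [of q1] q \<rho>01 N by (smt (verit) mult_less_cancel_left2)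
    then have "norm (qseries b q2) \<le> N * (norm q1 * s)"
      using two_point [OF b b0 bound, of q1 q2] q \<rho>01 eq by (auto simp: s_def)
    also have "\<dots> \<le> N * (s * s)"
      using q s N by (intro mult_left_mono mult_right_mono) (auto simp: s_def)
    finally have "norm (qseries b q2) * (N - s) \<le> N * (s * s) * (N - s)"
      using s by (intro mult_right_mono) auto
    moreover have "N * s * (1 - N * s) \<le> norm (qseries b q2) * (N - s)"
      using low [of q2] q \<rho>01 by (simp add: s_def)
    ultimately have "(N * s) * (1 - N * s) \<le> (N * s) * (s * (N - s))"
      by (simp add: mult_ac)
    then have "1 - N * s \<le> s * (N - s)" using s N by simp
    with quad [OF s(2)] show False by simp
  qed
  show inj: "inj_on (qseries b) (ball 0 \<rho>)"
  proof (rule inj_onI)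
    fix x y assume "x \<in> ball 0 \<rho>" "y \<in> ball 0 \<rho>" "qseries b x = qseries b y"
    then show "x = y" using aux [of x y] aux [of y x] by force
  qed
  show "ball 0 (N * \<rho>\<^sup>2) \<subseteq> qseries b ` ball 0 \<rho>"
  proof
    fix w assume "w \<in> ball (0::quat) (N * \<rho>\<^sup>2)"
    then have w: "norm w < N * \<rho>\<^sup>2" by simp
    define G where "G s = N * s * (1 - N * s) - norm w * (N - s)" for s
    have "G \<rho> = (N * \<rho>\<^sup>2 - norm w) * (N - \<rho>)"
      by (simp add: G_def root [symmetric] power2_eq_square algebra_simps)
    also have "\<dots> > 0" using w \<rho>01 N by simp
    finally have "G \<rho> > 0" .
    moreover have "(G \<longlongrightarrow> G \<rho>) (at_left \<rho>)"
      unfolding G_def by (intro tendsto_intros)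
    ultimately have "eventually (\<lambda>s. 0 < G s) (at_left \<rho>)"
      by (auto dest: order_tendstoD)
    moreover have "eventually (\<lambda>s. s \<in> {0<..<\<rho>}) (at_left \<rho>)"
      using \<rho>01 by (rule_tac eventually_at_left_real)
    ultimately have "eventually (\<lambda>s. 0 < G s \<and> s \<in> {0<..<\<rho>}) (at_left \<rho>)"
      by (rule eventually_conj)
    then obtain s where s: "0 < G s" "0 < s" "s < \<rho>"
      using eventually_happens' [of "at_left \<rho>"] by (auto simp: trivial_limit_at_left_real)
    have "w \<in> qseries b ` ball 0 s"
    proof (rule injective_ball_image_covers)
      show "continuous_on (cball 0 s) (qseries b)"
        using continuous_on_qseries [OF b] by (rule continuous_on_subset) (use s \<rho>01 in auto)
      show "inj_on (qseries b) (cball 0 s)"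
        using inj by (rule inj_on_subset) (use s in auto)
      fix x :: quat assume x: "norm x = s"
      have "N * s * (1 - N * s) \<le> norm (qseries b x) * (N - s)"
        using low [of x] x s \<rho>01 by simp
      then have "norm w * (N - s) < norm (qseries b x) * (N - s)"
        using s(1) by (simp add: G_def)
      then show "norm w < norm (qseries b x)"
        using s \<rho>01 N by simp
    qed (use s b0 in auto)
    then show "w \<in> qseries b ` ball 0 \<rho>" using s by auto
  qed
qed

section \<open>Rescaling and the Bergman space\<close>

text \<open>The preceding theorem applied to \<open>f(r q) / r\<close>, which is bounded by \<open>M / r\<close>.\<close>

lemma rescaled_landau_bloch:
  assumes c: "unit_radius c" and c0: "c 0 = 0" and c1: "c 1 = 1"
    and r: "0 < r" "r < 1" and M: "1 \<le> M"
    and bound: "\<And>q. norm q < r \<Longrightarrow> norm (qseries c q) \<le> M"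
  defines "s \<equiv> M - sqrt (M\<^sup>2 - r\<^sup>2)"
  shows "inj_on (qseries c) (ball 0 s)"
    and "ball 0 (M * s\<^sup>2 / r\<^sup>2) \<subseteq> qseries c ` ball 0 s"
    and "s \<le> 1" "M * s\<^sup>2 / r\<^sup>2 \<le> 1"
proof -
  define b where "b n = (r ^ n / r) *\<^sub>R c n" for n
  define N where "N = M / r"
  define \<rho> where "\<rho> = N - sqrt (N\<^sup>2 - 1)"
  have rM: "r\<^sup>2 < M\<^sup>2" using r M by (intro power_strict_mono) auto
  have N: "1 < N" using r M by (simp add: N_def)
  have s: "s = r * \<rho>"
  proof -
    have "N\<^sup>2 - 1 = (M\<^sup>2 - r\<^sup>2) / r\<^sup>2" using r by (simp add: N_def power_divide diff_divide_distrib)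
    then have "sqrt (N\<^sup>2 - 1) = sqrt (M\<^sup>2 - r\<^sup>2) / r" using r by (simp add: real_sqrt_divide)
    then show ?thesis using r by (simp add: s_def \<rho>_def N_def right_diff_distrib)
  qed
  have b: "unit_radius b"
  proof (rule unit_radius_norm_le [OF c, of _ "1 / r"])
    show "norm (b n) \<le> 1 / r * norm (c n)" for n
      using r by (simp add: b_def divide_right_mono mult_left_le_one_le power_le_one)
  qed
  have scale: "qseries b q = qseries c (r *\<^sub>R q) /\<^sub>R r" if "norm q < 1" for q
  proof -
    have "norm (r *\<^sub>R q) < 1"
      using r that mult_right_mono [of r 1 "norm q"] by simp
    then have "(\<lambda>n. inverse r *\<^sub>R ((r *\<^sub>R q) ^ n * c n)) sums (qseries c (r *\<^sub>R q) /\<^sub>R r)"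
      by (intro sums_scaleR_right qseries_sums c)
    moreover have "inverse r *\<^sub>R ((r *\<^sub>R q) ^ n * c n) = q ^ n * b n" for n
      by (simp add: b_def scaleR_power divide_inverse mult.commute)
    ultimately show ?thesis by (simp add: qseries_def sums_iff)
  qed
  have bN: "norm (qseries b q) \<le> N" if "norm q < 1" for q
    using bound [of "r *\<^sub>R q"] that r by (simp add: scale N_def divide_inverse mult.commute mult_left_mono)
  have lb: "inj_on (qseries b) (ball 0 \<rho>)" "ball 0 (N * \<rho>\<^sup>2) \<subseteq> qseries b ` ball 0 \<rho>"
    unfolding \<rho>_def
    by (rule landau_bloch_series [OF b _ _ N bN]; use r c0 c1 in \<open>simp add: b_def\<close>)+
  define D where "D = sqrt (M\<^sup>2 - r\<^sup>2)"
  have D: "D\<^sup>2 = M\<^sup>2 - r\<^sup>2" "0 < D" using rM by (simp_all add: D_def)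
  have sD: "s = M - D" by (simp add: s_def D_def)
  have "D < M" using D M r by (intro power2_less_imp_less [of D M]) auto
  have "M - r < D"
  proof (rule power2_less_imp_less)
    have "r * r < M * r" using r M by (intro mult_strict_right_mono) auto
    then show "(M - r)\<^sup>2 < D\<^sup>2" unfolding D by (simp add: power2_eq_square algebra_simps)
  qed (use D in simp)
  then have s01: "0 < s" "s < r" using \<open>D < M\<close> by (simp_all add: sD)
  then show s1: "s \<le> 1" using r by simp
  have "D * D \<le> M * D" using \<open>D < M\<close> D by (intro mult_right_mono) auto
  then have "M * s \<le> r\<^sup>2"
    using D(1) by (simp add: sD power2_eq_square algebra_simps)
  then have "(M * s) * s \<le> r\<^sup>2 * 1" using s01 s1 by (intro mult_mono) auto
  then show "M * s\<^sup>2 / r\<^sup>2 \<le> 1"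
    using r by (simp add: power2_eq_square mult.assoc)
  have \<rho>: "\<rho> = s / r" "\<rho> < 1" using s s01 r by simp_all
  have eq: "qseries c q = r *\<^sub>R qseries b (q /\<^sub>R r)" and mem: "q /\<^sub>R r \<in> ball 0 \<rho>" if "q \<in> ball 0 s" for q
  proof -
    show mem: "q /\<^sub>R r \<in> ball 0 \<rho>" using that r by (simp add: \<rho>(1) divide_inverse mult.commute)
    then have "norm (q /\<^sub>R r) < 1" using \<rho>(2) by simp
    from scale [OF this] show "qseries c q = r *\<^sub>R qseries b (q /\<^sub>R r)" using r by simp
  qed
  show "inj_on (qseries c) (ball 0 s)"
  proof (rule inj_onI)
    fix x y assume x: "x \<in> ball 0 s" and y: "y \<in> ball 0 s" and xy: "qseries c x = qseries c y"
    then have "qseries b (x /\<^sub>R r) = qseries b (y /\<^sub>R r)"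
      using r by (simp add: eq)
    then have "x /\<^sub>R r = y /\<^sub>R r"
      using inj_onD [OF lb(1) _ mem [OF x] mem [OF y]] by blast
    then show "x = y" using r by simp
  qed
  show "ball 0 (M * s\<^sup>2 / r\<^sup>2) \<subseteq> qseries c ` ball 0 s"
  proof
    fix w assume "w \<in> ball (0::quat) (M * s\<^sup>2 / r\<^sup>2)"
    then have "norm w < M * s\<^sup>2 / r\<^sup>2" by simp
    then have "norm w / r < M * s\<^sup>2 / r\<^sup>2 / r" by (rule divide_strict_right_mono) (use r in simp)
    also have "\<dots> = N * \<rho>\<^sup>2" by (simp add: N_def \<rho>(1) power_divide)
    finally have "w /\<^sub>R r \<in> ball 0 (N * \<rho>\<^sup>2)" using r by (simp add: divide_inverse mult.commute)
    with lb(2) have "w /\<^sub>R r \<in> qseries b ` ball 0 \<rho>" by blast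
    then obtain x where x: "norm x < \<rho>" and wx: "w /\<^sub>R r = qseries b x" by auto
    have mem: "r *\<^sub>R x \<in> ball 0 s" using x r by (simp add: \<rho>(1) pos_less_divide_eq mult.commute)
    have "qseries c (r *\<^sub>R x) = r *\<^sub>R qseries b x" using eq [OF mem] r by simp
    also have "\<dots> = w" using r by (simp add: wx [symmetric])
    finally show "w \<in> qseries c ` ball 0 s" using mem by blast
  qed
qed

theorem theorem1p3:
  fixes p :: real and f :: "quat \<Rightarrow> quat"
  assumes "1 \<le> p"
    and "slice_regular_on f (ball 0 1)"
    and "f 0 = 0"
    and "slice_deriv f 0 = 1"
    and "bergman_norm p f \<le> 1"
  shows "inj_on f (ball 0 (landau_radius p)) \<and>
    ball 0 (bloch_radius p) \<subseteq> f ` ball 0 (landau_radius p)"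
proof -
  obtain c where c: "unit_radius c" and fc: "\<And>q. norm q < 1 \<Longrightarrow> f q = qseries c q"
    using slice_regular_power_series [OF assms(2)] by blast
  have cont: "continuous_on (ball 0 1) f"
    using continuous_on_qseries [OF c] by (rule continuous_on_eq) (simp add: fc)
  have c0: "c 0 = 0" using fc [of 0] assms(3) by simp
  have c1: "c 1 = 1" using slice_deriv_0 [OF assms(2) c fc] assms(4) by simp
  define M where "M r = (1 - r) powr (- 2 / p)" for r :: real
  define s where "s r = M r - sqrt ((M r)\<^sup>2 - r\<^sup>2)" for r
  have M2: "(M r)\<^sup>2 = (1 - r) powr (- 4 / p)" if "r \<in> {0<..<1}" for r
    using that by (simp add: M_def power2_eq_square powr_add [symmetric])
  have M1: "1 \<le> M r" if "r \<in> {0<..<1}" for r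
    using that assms(1) powr_mono2' [of "- 2 / p" "1 - r" 1] by (simp add: M_def)
  have bound: "norm (qseries c q) \<le> M r" if "r \<in> {0<..<1}" "norm q < r" for q r
  proof -
    have "norm (f q) \<le> (1 - norm q) powr (- 2 / p)"
      using point_evaluation [OF assms(1,2) cont assms(5)] that by simp
    also have "\<dots> \<le> M r"
      unfolding M_def using that assms(1) by (intro powr_mono2') auto
    finally show ?thesis using fc that by simp
  qed
  have lb: "inj_on (qseries c) (ball 0 (s r))"
    "ball 0 (M r * (s r)\<^sup>2 / r\<^sup>2) \<subseteq> qseries c ` ball 0 (s r)"
    "s r \<le> 1" "M r * (s r)\<^sup>2 / r\<^sup>2 \<le> 1" if r: "r \<in> {0<..<1}" for r
    unfolding s_def
    by (rule rescaled_landau_bloch [OF c c0 c1 _ _ M1 [OF r] bound [OF r]]; use r in simp)+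
  have landau: "landau_radius p = (SUP r\<in>{0<..<1}. s r)"
    unfolding landau_radius_def by (intro SUP_cong refl) (simp add: s_def M2, simp add: M_def)
  have bloch: "bloch_radius p = (SUP r\<in>{0<..<1}. M r * (s r)\<^sup>2 / r\<^sup>2)"
    unfolding bloch_radius_def
  proof (intro SUP_cong refl)
    fix r :: real assume r: "r \<in> {0<..<1}"
    have "r powi (- 2) = inverse (r\<^sup>2)" by (simp add: power_int_minus)
    then show "r powi (- 2) * (1 - r) powr (- 2 / p) *
        ((1 - r) powr (- 2 / p) - sqrt ((1 - r) powr (- 4 / p) - r\<^sup>2))\<^sup>2 = M r * (s r)\<^sup>2 / r\<^sup>2"
      unfolding s_def M2 [OF r] by (simp add: M_def divide_inverse)
  qed
  have bdd: "bdd_above (s ` {0<..<1})" "bdd_above ((\<lambda>r. M r * (s r)\<^sup>2 / r\<^sup>2) ` {0<..<1})"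
    using lb(3,4) by (auto intro!: bdd_aboveI [of _ 1])
  have s_le: "s r \<le> landau_radius p" if "r \<in> {0<..<1}" for r
    unfolding landau using bdd(1) that by (rule cSUP_upper [rotated])
  show ?thesis
  proof
    show "inj_on f (ball 0 (landau_radius p))"
    proof (rule inj_onI)
      fix x y assume xy: "x \<in> ball 0 (landau_radius p)" "y \<in> ball 0 (landau_radius p)" "f x = f y"
      then have "max (norm x) (norm y) < (SUP r\<in>{0<..<1}. s r)" by (simp add: landau)
      then obtain r where r: "r \<in> {0<..<1}" "max (norm x) (norm y) < s r"
        using less_cSUP_iff [OF _ bdd(1), THEN iffD1, of "max (norm x) (norm y)"]
        by (auto simp del: max_less_iff_conj)
      then have "s r \<le> 1" "inj_on (qseries c) (ball 0 (s r))" using lb(1,3) [of r] by auto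
      with r xy show "x = y" by (auto simp: inj_on_def fc)
    qed
    show "ball 0 (bloch_radius p) \<subseteq> f ` ball 0 (landau_radius p)"
    proof
      fix w assume "w \<in> ball (0::quat) (bloch_radius p)"
      then have "norm w < (SUP r\<in>{0<..<1}. M r * (s r)\<^sup>2 / r\<^sup>2)" by (simp add: bloch)
      then obtain r where r: "r \<in> {0<..<1}" "norm w < M r * (s r)\<^sup>2 / r\<^sup>2"
        using less_cSUP_iff [OF _ bdd(2), THEN iffD1, of "norm w"] by auto
      then obtain x where x: "norm x < s r" "w = qseries c x" using lb(2) [of r] by force
      have "norm x < 1" "norm x < landau_radius p" using x lb(3) [of r] s_le [OF r(1)] r by auto
      with x show "w \<in> f ` ball 0 (landau_radius p)"
        by (intro image_eqI [of _ _ x]) (auto simp: fc)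
    qed
  qed
qed

end
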